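(* Let $T\subset\mathbb{R}^n$ be closed, let $I\subset\mathbb{Z}_+^n$ be finite with $0\in I$, and let $g=(g_i)_{i\in I}$ be a family of real numbers with $g_0=1$. Set $m=\max_{i\in I}|i|$ and $N=\operatorname{card} I$. Let $a,\rho$ be measurable functions on $T$ with $0<a<\infty$ and $0<\rho<\infty$ a.e., such that $$\int_T e^{\frac{\|t\|^m+1}{\alpha\,a(t)}}\rho(t)\,dt<\infty\quad\text{for all }\alpha>0,$$ and such that $a$ is independent of $(t^i)_{i\in I\setminus\{0\}}$. Then the following statements (a), (b), (c) are equivalent. (a) There exists $f\in L^1_+(T,dt)$ such that $\int_T|t^i|f(t)\,dt<\infty$ and $$\int_T t^i f(t)\,dt=g_i\qquad(i\in I).\qquad( * )$$ (b) There exists a particular solution $f_*\in L^1_+(T,dt)$ of problem $( * )$ maximizing, amongst all solutions of $( * )$, the functional $H:L^1_+(T,dt)\to[-\infty,\infty)$ given by $$H(f)=-\int_T\Big(\frac{af}{\rho}\ln\frac{af}{\rho}\Big)\,\rho\,dt.$$ (c) The function $L:\mathbb{R}^N\to[-\infty,\infty)$ given by $$L(\lambda)=\sum_{i\in I}g_i\lambda_i-\int_T e^{\sum_{i\in I}\lambda_i t^i/a(t)\,-1}\,\rho(t)\,dt\qquad(\lambda=(\lambda_i)_{i\in I})$$ is bounded from above and attains its supremum at a point $\lambda^*=(\lambda_i^* )_{i\in I}$. In this case $f_*$ and $\lambda^*$ are uniquely determined, $-H(f_* )=L(\lambda^* )$, and $$f_*(t)=a(t)^{-1}\rho(t)\,e^{\sum_{i\in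 I}\lambda_i^*t^i/a(t)-1}\qquad(t\in T);$$ in particular $H\not\equiv-\infty$ on the set of all solutions of $( * )$, and $$\int_T t^i\,e^{\frac{1}{a(t)}\sum_{j\in I}\lambda_j^*t^j-1}\,a(t)^{-1}\rho(t)\,dt=g_i\qquad(i\in I).$$
   Context: $\mathbb{Z}_+=\{0,1,2,\dots\}$; $dt$ is Lebesgue measure on $\mathbb{R}^n$; for $i=(i_1,\dots,i_n)\in\mathbb{Z}_+^n$, $t^i=t_1^{i_1}\cdots t_n^{i_n}$ and $|i|=i_1+\cdots+i_n$. $\|\cdot\|$ is a norm on $\mathbb{R}^n$ (the choice is unimportant; e.g. the Euclidean norm). $L^1_+(T,dt)$ is the set of (classes of) Lebesgue integrable functions on $T$ that are $\ge 0$ a.e. A solution of $( * )$ is an $f\in L^1_+(T,dt)$ with $\int_T|t^i|f\,dt<\infty$ for all $i\in I$ satisfying $( * )$. The convention $0\ln 0=0$ is used. A function $a$ on $T$ is called independent of $(t^i)_{i\in I\setminus\{0\}}$ if there are no measurable subset $Z\subset T$ of positive Lebesgue measure and constants $(c_i)_{i\in I\setminus\{0\}}$ such that $a(t)=\sum_{i\in I\setminus\{0\}}c_it^i$ on $Z$. *)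

theory Defs
  imports "HOL-Analysis.Analysis"
begin

definition is_norm :: "('a::real_vector \<Rightarrow> real) \<Rightarrow> bool" where
  "is_norm \<nu> \<longleftrightarrow>
     (\<forall>x. \<nu> x = 0 \<longleftrightarrow> x = 0) \<and>
     (\<forall>c x. \<nu> (c *\<^sub>R x) = \<bar>c\<bar> * \<nu> x) \<and>
     (\<forall>x y. \<nu> (x + y) \<le> \<nu> x + \<nu> y)"

(* Multi-indices are elements of the type nat ^ 'n. *)

definition multi_deg :: "nat ^ 'n \<Rightarrow> nat" where
  "multi_deg i = (\<Sum>k\<in>UNIV. i $ k)"

definition mpow :: "real ^ 'n \<Rightarrow> nat ^ 'n \<Rightarrow> real" where
  "mpow t i = (\<Prod>k\<in>UNIV. (t $ k) ^ (i $ k))"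

definition indep_of_monomials ::
  "(real ^ 'n) set \<Rightarrow> (nat ^ 'n) set \<Rightarrow> (real ^ 'n \<Rightarrow> real) \<Rightarrow> bool" where
  "indep_of_monomials T J a \<longleftrightarrow>
     \<not> (\<exists>Z c. Z \<subseteq> T \<and> Z \<in> sets lebesgue \<and> emeasure lebesgue Z > 0 \<and>
          (\<forall>t\<in>Z. a t = (\<Sum>i\<in>J. c i * mpow t i)))"

(* Elements of L1 are given by representatives, so two of them are identified when they agree
   almost everywhere on T. *)

definition L1_plus :: "(real ^ 'n) set \<Rightarrow> (real ^ 'n \<Rightarrow> real) set" where
  "L1_plus T = {f. integrable (lebesgue_on T) f \<and> (AE t in lebesgue_on T. 0 \<le> f t)}"

definition moment_solution ::
  "(real ^ 'n) set \<Rightarrow> (nat ^ 'n) set \<Rightarrow> (nat ^ 'n \<Rightarrow> real) \<Rightarrow> (real ^ 'n \<Rightarrow> real) \<Rightarrow> bool" where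
  "moment_solution T I g f \<longleftrightarrow>
     f \<in> L1_plus T \<and>
     (\<forall>i\<in>I. integrable (lebesgue_on T) (\<lambda>t. \<bar>mpow t i\<bar> * f t) \<and>
            (\<integral>t. mpow t i * f t \<partial>lebesgue_on T) = g i)"

(* The Lebesgue integral with values in the extended reals. It is meaningful only if one of
   the two parts is finite; for the entropy below the negative part is, because
   x * ln x \<ge> - exp (-1) and the weight is integrable. *)

definition ext_integral :: "'a measure \<Rightarrow> ('a \<Rightarrow> real) \<Rightarrow> ereal" where
  "ext_integral M u =
     enn2ereal (\<integral>\<^sup>+ x. ennreal (u x) \<partial>M) - enn2ereal (\<integral>\<^sup>+ x. ennreal (- u x) \<partial>M)"

(* The product vanishes where f t = 0, in accordance with the convention 0 ln 0 = 0. *)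

definition entropy ::
  "(real ^ 'n) set \<Rightarrow> (real ^ 'n \<Rightarrow> real) \<Rightarrow> (real ^ 'n \<Rightarrow> real) \<Rightarrow> (real ^ 'n \<Rightarrow> real) \<Rightarrow> ereal"
  where
  "entropy T a \<rho> f =
     - ext_integral (lebesgue_on T)
         (\<lambda>t. (a t * f t / \<rho> t * ln (a t * f t / \<rho> t)) * \<rho> t)"

definition entropy_maximizer ::
  "(real ^ 'n) set \<Rightarrow> (nat ^ 'n) set \<Rightarrow> (nat ^ 'n \<Rightarrow> real) \<Rightarrow> (real ^ 'n \<Rightarrow> real) \<Rightarrow>
   (real ^ 'n \<Rightarrow> real) \<Rightarrow> (real ^ 'n \<Rightarrow> real) \<Rightarrow> bool" where
  "entropy_maximizer T I g a \<rho> f \<longleftrightarrow>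
     moment_solution T I g f \<and>
     (\<forall>h. moment_solution T I g h \<longrightarrow> entropy T a \<rho> h \<le> entropy T a \<rho> f)"

(* Vectors of length card I indexed by I are the extensional functions in I \<rightarrow>\<^sub>E UNIV. *)

definition dual_functional ::
  "(real ^ 'n) set \<Rightarrow> (nat ^ 'n) set \<Rightarrow> (nat ^ 'n \<Rightarrow> real) \<Rightarrow> (real ^ 'n \<Rightarrow> real) \<Rightarrow>
   (real ^ 'n \<Rightarrow> real) \<Rightarrow> (nat ^ 'n \<Rightarrow> real) \<Rightarrow> ereal" where
  "dual_functional T I g a \<rho> l =
     ereal (\<Sum>i\<in>I. g i * l i) -
     enn2ereal (\<integral>\<^sup>+ t. ennreal (exp ((\<Sum>i\<in>I. l i * mpow t i / a t) - 1) * \<rho> t) \<partial>lebesgue_on T)"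

definition dual_maximizer ::
  "(real ^ 'n) set \<Rightarrow> (nat ^ 'n) set \<Rightarrow> (nat ^ 'n \<Rightarrow> real) \<Rightarrow> (real ^ 'n \<Rightarrow> real) \<Rightarrow>
   (real ^ 'n \<Rightarrow> real) \<Rightarrow> (nat ^ 'n \<Rightarrow> real) \<Rightarrow> bool" where
  "dual_maximizer T I g a \<rho> l \<longleftrightarrow>
     l \<in> I \<rightarrow>\<^sub>E UNIV \<and>
     dual_functional T I g a \<rho> l = (SUP k \<in> I \<rightarrow>\<^sub>E UNIV. dual_functional T I g a \<rho> k)"

end

theory Submission
  imports Defs "HOL-Computational_Algebra.Polynomial"
begin

text \<open>Write \<open>w = a f / \<rho>\<close> and \<open>y = (\<Sum>i\<in>I. l i * t^i) / a\<close>. The functions \<open>w ln w\<close> and \<open>exp (y - 1)\<close> are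
convex conjugates of each other, so Young's inequality \<open>w y \<le> w ln w + exp (y - 1)\<close> holds, with
equality exactly for \<open>w = exp (y - 1)\<close>. Multiplied by \<open>\<rho>\<close> and integrated, the left-hand side becomes
\<open>\<Sum>i\<in>I. g i * l i\<close> for every solution \<open>f\<close> of the moment problem. This is weak duality, \<open>L l \<le> - H f\<close>
(\<open>weak_duality\<close>), and its equality case says that \<open>f\<close> is the density
\<open>exp (y - 1) * \<rho> / a\<close>, called \<open>gibbs l\<close> below.

If \<open>l\<close> maximizes \<open>L\<close>, the first-order conditions at \<open>l\<close> state precisely that \<open>gibbs l\<close> has the moments
\<open>g\<close> (\<open>gibbs_feasible_if_dual_max\<close>). For this density there is no duality gap
(\<open>strong_duality\<close>). Hence it maximizes \<open>H\<close>, and the equality case makes it the only maximizer. The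
equality case also makes \<open>l\<close> unique: two dual maximizers have almost everywhere the same density, hence
polynomials that agree almost everywhere, hence the same coefficients.

It remains to attain the supremum of \<open>L\<close> when the moment problem has some solution \<open>f\<close>, possibly with
\<open>H f = -\<infinity>\<close>. By the growth hypothesis \<open>L\<close> is finite, concave and continuous, so it is enough that it
falls below its value at the origin on every ray through some \<open>d \<noteq> 0\<close>
(\<open>concave_attains_max_if_unbounded_below_on_rays\<close>). Along such a ray \<open>L\<close> equals
\<open>s * \<integral> p f - \<integral> exp (s p / a - 1) \<rho>\<close> with \<open>p = \<Sum>i\<in>I. d i * t^i\<close>. If \<open>p > 0\<close> on a set of positive measure,
the exponential beats the linear term. Otherwise \<open>p < 0\<close> almost everywhere, because the zero set of a nonzero
polynomial is negligible (\<open>negligible_zeros_polynomial\<close>), and then the linear term tends to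
\<open>-\<infinity>\<close>, because \<open>f\<close> has mass \<open>g 0 = 1\<close>.\<close>

section \<open>Zero sets of polynomials\<close>

text \<open>The translates all have the measure of \<open>S\<close> and lie in one ball \<open>B\<close>. Since they cover no point more than
\<open>D\<close> times, the first \<open>K\<close> of them have total measure at most \<open>D\<close> times that of \<open>B\<close>, for every \<open>K\<close>.\<close>

lemma negligible_if_few_translates_meet:
  fixes S :: "'a::euclidean_space set" and \<gamma> :: "nat \<Rightarrow> 'a"
  assumes S: "S \<in> lmeasurable" "bounded S" and \<gamma>: "bounded (range \<gamma>)"
    and few: "\<And>x. finite {j. x \<in> (+) (\<gamma> j) ` S}" "\<And>x. card {j. x \<in> (+) (\<gamma> j) ` S} \<le> D"
  shows "negligible S"
proof -
  obtain b c where b: "\<And>x. x \<in> S \<Longrightarrow> norm x \<le> b" and c: "\<And>j. norm (\<gamma> j) \<le> c"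
    using S(2) \<gamma> by (auto simp: bounded_iff)
  define B :: "'a set" where "B = cball 0 (b + c)"
  have sub: "(+) (\<gamma> j) ` S \<subseteq> B" for j
  proof
    fix x assume "x \<in> (+) (\<gamma> j) ` S"
    then obtain s where "s \<in> S" "x = \<gamma> j + s" by auto
    then have "norm x \<le> b + c" using norm_triangle_ineq[of "\<gamma> j" s] b[of s] c[of j] by auto
    then show "x \<in> B" by (simp add: B_def)
  qed
  have meas: "(+) (\<gamma> j) ` S \<in> lmeasurable" for j
    using S(1) by (rule measurable_translation)
  have int_ind: "integrable lebesgue (indicator ((+) (\<gamma> j) ` S) :: 'a \<Rightarrow> real)" for j
    using meas[of j] by (intro integrable_real_indicator) (unfold fmeasurable_def, blast+)
  have bound: "real K * measure lebesgue S \<le> D * measure lebesgue B" for K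
  proof -
    have "real K * measure lebesgue S = (\<Sum>j<K. measure lebesgue ((+) (\<gamma> j) ` S))"
      by (simp add: measure_translation)
    also have "\<dots> = (\<Sum>j<K. \<integral>x. indicator ((+) (\<gamma> j) ` S) x \<partial>lebesgue)"
      using meas by (intro sum.cong) (auto simp: fmeasurableD)
    also have "\<dots> = (\<integral>x. (\<Sum>j<K. indicator ((+) (\<gamma> j) ` S) x) \<partial>lebesgue)"
      using meas by (subst Bochner_Integration.integral_sum) (auto intro: int_ind)
    also have "\<dots> \<le> (\<integral>x. real D * indicator B x \<partial>lebesgue)"
    proof (rule integral_mono)
      show "integrable lebesgue (\<lambda>x. \<Sum>j<K. indicator ((+) (\<gamma> j) ` S) x :: real)"
        by (intro Bochner_Integration.integrable_sum int_ind)
      show "integrable lebesgue (\<lambda>x. real D * indicator B x)"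
        using lmeasurable_cball[of 0 "b + c"]
        by (intro integrable_mult_right integrable_real_indicator) (auto simp: fmeasurable_def B_def)
    next
      fix x
      have "(\<Sum>j<K. indicator ((+) (\<gamma> j) ` S) x :: real) = card ({..<K} \<inter> {j. x \<in> (+) (\<gamma> j) ` S})"
        by (simp add: indicator_def sum.If_cases of_bool_def)
      also have "\<dots> \<le> real D * indicator B x"
      proof (cases "x \<in> B")
        case True
        have "card ({..<K} \<inter> {j. x \<in> (+) (\<gamma> j) ` S}) \<le> card {j. x \<in> (+) (\<gamma> j) ` S}"
          using few(1) by (intro card_mono) auto
        then show ?thesis using few(2)[of x] True by simp
      next
        case False
        then have "{j. x \<in> (+) (\<gamma> j) ` S} = {}" using sub by blast
        then show ?thesis by (metis False Int_empty_right card.empty indicator_simps(2) mult_zero_right of_nat_0 order_refl)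
      qed
      finally show "(\<Sum>j<K. indicator ((+) (\<gamma> j) ` S) x) \<le> real D * (indicator B x :: real)" .
    qed
    also have "\<dots> = D * measure lebesgue B"
      by (simp add: B_def)
    finally show ?thesis .
  qed
  have "measure lebesgue S = 0"
  proof (rule ccontr)
    assume "measure lebesgue S \<noteq> 0"
    then have "measure lebesgue S > 0" by (simp add: zero_less_measure_iff)
    then obtain K where "D * measure lebesgue B < real K * measure lebesgue S"
      using reals_Archimedean3 by blast
    then show False using bound[of K] by simp
  qed
  then show ?thesis using S(1) by (simp add: negligible_iff_measure)
qed

definition weighted_deg :: "('n::finite \<Rightarrow> nat) \<Rightarrow> nat ^ 'n \<Rightarrow> nat" where
  "weighted_deg w i = (\<Sum>k\<in>UNIV. w k * i $ k)"

text \<open>Kronecker substitution: with weights \<open>x ^ e k\<close>, where \<open>e\<close> numbers the coordinates, two distinct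
multi-indices have the same weighted degree only if \<open>x\<close> is a root of a certain nonzero polynomial in one
variable. Finitely many pairs of multi-indices exclude finitely many \<open>x\<close>.\<close>

lemma separating_weights:
  fixes I :: "(nat ^ 'n) set"
  assumes "finite I"
  obtains w :: "'n \<Rightarrow> nat" where "inj_on (weighted_deg w) I" "\<And>k. w k > 0"
proof -
  obtain e :: "'n \<Rightarrow> nat" where e: "inj e"
    using finite_imp_inj_to_nat_seg[of "UNIV :: 'n set"] by auto
  define q :: "(nat ^ 'n) \<times> (nat ^ 'n) \<Rightarrow> real poly" where
    "q = (\<lambda>(i, j). \<Sum>k\<in>UNIV. monom (real (i $ k) - real (j $ k)) (e k))"
  define P where "P = (\<Prod>p\<in>{p \<in> I \<times> I. fst p \<noteq> snd p}. q p)"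
  have coeff: "coeff (q (i, j)) (e k) = real (i $ k) - real (j $ k)" for i j k
    using e by (auto simp: q_def coeff_sum coeff_monom inj_eq sum.delta)
  have "q (i, j) \<noteq> 0" if "i \<noteq> j" for i j
  proof -
    from that obtain k where "i $ k \<noteq> j $ k" by (auto simp: vec_eq_iff)
    then have "coeff (q (i, j)) (e k) \<noteq> 0" by (simp add: coeff)
    then show ?thesis by force
  qed
  then have "P \<noteq> 0" using assms by (auto simp: P_def)
  then have "finite {x. poly P x = 0}" by (rule poly_roots_finite)
  moreover have "infinite ((\<lambda>N::nat. real (Suc N)) ` UNIV)"
    by (rule range_inj_infinite) (auto simp: inj_def)
  \<comment> \<open>the successor makes the weights positive\<close>
  ultimately obtain N :: nat where N: "poly P (real (Suc N)) \<noteq> 0"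
    by (metis (mono_tags, lifting) finite_subset image_subset_iff mem_Collect_eq)
  define w where "w = (\<lambda>k. Suc N ^ e k)"
  have "inj_on (weighted_deg w) I"
  proof (rule inj_onI, rule ccontr)
    fix i j assume ij: "i \<in> I" "j \<in> I" "weighted_deg w i = weighted_deg w j" "i \<noteq> j"
    have "poly (q (i, j)) (real (Suc N)) = real (weighted_deg w i) - real (weighted_deg w j)"
      by (simp add: q_def poly_sum poly_monom weighted_deg_def w_def algebra_simps sum_subtractf
           del: of_nat_Suc)
    then have "poly P (real (Suc N)) = 0"
      using ij assms unfolding P_def poly_prod by (subst prod_zero_iff) (auto intro!: bexI[of _ "(i, j)"])
    with N show False by simp
  qed
  moreover have "w k > 0" for k by (simp add: w_def)
  ultimately show thesis by (rule that)
qed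

text \<open>The zero set is moved along the curve \<open>s \<mapsto> - (s ^ w k)\<close> (over the coordinates \<open>k\<close>) for weights \<open>w\<close> that
separate the exponents. A point \<open>x\<close> lies in the translate with parameter \<open>s\<close> iff the polynomial vanishes at
\<open>x + s ^ w\<close>. As a polynomial in \<open>s\<close> this has a degree and a leading coefficient that do not depend
on \<open>x\<close>: there is a single exponent of largest weighted degree, so its coefficient cannot cancel. Hence each
point lies in a bounded number of translates.\<close>

lemma negligible_zeros_polynomial:
  fixes I :: "(nat ^ 'n) set" and d :: "nat ^ 'n \<Rightarrow> real"
  assumes I: "finite I" and d: "\<exists>i\<in>I. d i \<noteq> 0"
  shows "negligible {t. (\<Sum>i\<in>I. d i * mpow t i) = 0}" (is "negligible ?Z")
proof -
  define J where "J = {i \<in> I. d i \<noteq> 0}"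
  have J: "finite J" "J \<noteq> {}" using assms by (auto simp: J_def)
  have sumJ: "(\<Sum>i\<in>I. d i * mpow t i) = (\<Sum>i\<in>J. d i * mpow t i)" for t
    using I by (intro sum.mono_neutral_right) (auto simp: J_def)
  obtain w :: "'n \<Rightarrow> nat" where w: "inj_on (weighted_deg w) J" "\<And>k. w k > 0"
    using separating_weights[OF J(1)] by blast
  define M where "M = Max (weighted_deg w ` J)"
  obtain i0 where i0: "i0 \<in> J" "weighted_deg w i0 = M"
    using Max_in[of "weighted_deg w ` J"] J unfolding M_def by (metis finite_imageI image_iff image_is_empty)
  have le_M: "weighted_deg w i \<le> M" if "i \<in> J" for i using J that by (auto simp: M_def)
  define Q :: "real ^ 'n \<Rightarrow> nat ^ 'n \<Rightarrow> real poly" where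
    "Q = (\<lambda>x i. \<Prod>k\<in>UNIV. ([:x $ k:] + monom 1 (w k)) ^ (i $ k))"
  define P where "P = (\<lambda>x. \<Sum>i\<in>J. smult (d i) (Q x i))"
  have fac: "degree ([:c:] + monom (1::real) (w k)) = w k" "lead_coeff ([:c:] + monom (1::real) (w k)) = 1"
    for c k
  proof -
    show *: "degree ([:c:] + monom (1::real) (w k)) = w k"
      using w(2)[of k] by (subst degree_add_eq_right) (auto simp: degree_monom_eq)
    show "lead_coeff ([:c:] + monom (1::real) (w k)) = 1"
      unfolding * using w(2)[of k] by (simp add: coeff_pCons split: nat.split)
  qed
  have fac0: "[:c:] + monom (1::real) (w k) \<noteq> 0" for c k
    using fac(2)[of c k] by force
  have degQ: "degree (Q x i) = weighted_deg w i" for x i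
    by (simp add: Q_def degree_prod_eq_sum_degree fac0 degree_power_eq fac weighted_deg_def mult.commute)
  have leadQ: "lead_coeff (Q x i) = 1" for x i
    unfolding Q_def lead_coeff_prod lead_coeff_power fac(2) by simp
  have degP: "degree (P x) \<le> M" for x
    unfolding P_def using J le_M by (intro degree_sum_le) (auto intro: order_trans[OF degree_smult_le] simp: degQ)
  have "coeff (P x) M = d i0" for x
  proof -
    have "coeff (smult (d i) (Q x i)) M = (if i = i0 then d i0 else 0)" if "i \<in> J" for i
    proof (cases "i = i0")
      case True
      then show ?thesis using leadQ[of x i0] by (simp add: degQ i0)
    next
      case False
      then have "weighted_deg w i \<noteq> M" using w(1) that i0 by (auto simp: inj_on_def)
      then have "weighted_deg w i < M" using le_M[OF that] by simp
      then show ?thesis using False by (simp add: coeff_eq_0 degQ)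
    qed
    then have "coeff (P x) M = (\<Sum>i\<in>J. if i = i0 then d i0 else 0)"
      unfolding P_def coeff_sum by (intro sum.cong) auto
    then show ?thesis using i0 J by simp
  qed
  moreover have "d i0 \<noteq> 0" using i0(1) by (simp add: J_def)
  ultimately have P0: "P x \<noteq> 0" for x by (metis coeff_0)
  \<comment> \<open>infinitely many parameters in the unit interval, which keeps the translations bounded\<close>
  define s :: "nat \<Rightarrow> real" where "s = (\<lambda>j. 1 / real (Suc j))"
  have s: "inj s" "\<And>j. 0 \<le> s j" "\<And>j. s j \<le> 1" by (auto simp: s_def inj_def)
  define \<gamma> :: "nat \<Rightarrow> real ^ 'n" where "\<gamma> = (\<lambda>j. \<chi> k. - (s j ^ w k))"
  have polyP: "poly (P x) (s j) = (\<Sum>i\<in>J. d i * mpow (x - \<gamma> j) i)" for x j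
    by (simp add: P_def Q_def poly_sum poly_prod poly_monom mpow_def \<gamma>_def)
  have "bounded (range \<gamma>)"
    unfolding bounded_iff
  proof (intro exI ballI, elim rangeE, hypsubst)
    fix j
    have "norm (\<gamma> j) \<le> (\<Sum>k\<in>UNIV. \<bar>\<gamma> j $ k\<bar>)" by (rule norm_le_l1_cart)
    also have "\<dots> \<le> (\<Sum>k::'n\<in>UNIV. 1)"
      using s(2,3)[of j] by (intro sum_mono) (auto simp: \<gamma>_def intro: power_le_one)
    finally show "norm (\<gamma> j) \<le> (\<Sum>k::'n\<in>UNIV. 1)" .
  qed
  have few: "finite {j. x - \<gamma> j \<in> ?Z} \<and> card {j. x - \<gamma> j \<in> ?Z} \<le> M" for x
  proof -
    have eq: "{j. x - \<gamma> j \<in> ?Z} = {j. poly (P x) (s j) = 0}" by (simp add: sumJ polyP)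
    have inj: "inj_on s {j. poly (P x) (s j) = 0}" using s(1) by (meson inj_on_subset subset_UNIV)
    have sub: "s ` {j. poly (P x) (s j) = 0} \<subseteq> {r. poly (P x) r = 0}" by auto
    have fin: "finite {r. poly (P x) r = 0}" using P0 by (rule poly_roots_finite)
    have "card {j. poly (P x) (s j) = 0} \<le> card {r. poly (P x) r = 0}"
      using inj sub fin by (rule card_inj_on_le)
    also have "\<dots> \<le> degree (P x)" by (rule card_poly_roots_bound[OF P0])
    finally show ?thesis unfolding eq
      using degP[of x] finite_subset[OF sub fin] inj by (auto dest: finite_imageD)
  qed
  have closed: "closed ?Z"
    unfolding mpow_def by (intro closed_Collect_eq continuous_intros)
  show ?thesis
    unfolding negligible_on_intervals[of ?Z]
  proof (intro allI)
    fix a b :: "real ^ 'n"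
    have sub: "{j. x \<in> (+) (\<gamma> j) ` (?Z \<inter> cbox a b)} \<subseteq> {j. x - \<gamma> j \<in> ?Z}" for x by auto
    show "negligible (?Z \<inter> cbox a b)"
    proof (rule negligible_if_few_translates_meet)
      show "?Z \<inter> cbox a b \<in> lmeasurable"
        using closed by (intro lmeasurable_compact closed_Int_compact) auto
      show "bounded (?Z \<inter> cbox a b)" by (simp add: bounded_Int)
      show "bounded (range \<gamma>)" by fact
      show "finite {j. x \<in> (+) (\<gamma> j) ` (?Z \<inter> cbox a b)}" for x
        using sub few finite_subset by blast
      show "card {j. x \<in> (+) (\<gamma> j) ` (?Z \<inter> cbox a b)} \<le> M" for x
        using card_mono[OF _ sub, of x] few[of x] by linarith
    qed
  qed
qed

section \<open>Maxima of concave functions of finitely many variables\<close>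

lemma bounded_coordinates_convergent_subsequence:
  fixes x :: "nat \<Rightarrow> 'i \<Rightarrow> real"
  assumes "finite I" and "\<And>i. i \<in> I \<Longrightarrow> bounded (range (\<lambda>n. x n i))"
  shows "\<exists>r l. strict_mono (r :: nat \<Rightarrow> nat) \<and> (\<forall>i\<in>I. (\<lambda>n. x (r n) i) \<longlonglongrightarrow> l i)"
  using assms
proof (induction I rule: finite_induct)
  case empty
  show ?case by (intro exI[of _ id]) (auto simp: strict_mono_def)
next
  case (insert j I)
  then obtain r l where r: "strict_mono r" "\<And>i. i \<in> I \<Longrightarrow> (\<lambda>n. x (r n) i) \<longlonglongrightarrow> l i"
    by auto
  have "bounded (range (\<lambda>n. x (r n) j))"
    by (rule bounded_subset[of "range (\<lambda>n. x n j)"]) (use insert.prems in auto)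
  then obtain c s where s: "strict_mono s" "((\<lambda>n. x (r n) j) \<circ> s) \<longlonglongrightarrow> c"
    using bounded_imp_convergent_subsequence by blast
  have "(\<lambda>n. x (r (s n)) i) \<longlonglongrightarrow> (if i = j then c else l i)" if "i \<in> insert j I" for i
    using that s(2) LIMSEQ_subseq_LIMSEQ[OF r(2) s(1)] by (auto simp: o_def)
  then show ?case
    using strict_mono_o[OF r(1) s(1)]
    by (intro exI[of _ "r \<circ> s"] exI[of _ "\<lambda>i. if i = j then c else l i"] conjI) (assumption, simp)
qed

text \<open>The superlevel set at the value of the origin is bounded: otherwise the normalized directions of an unbounded
sequence in it accumulate at some \<open>e \<noteq> 0\<close>, concavity keeps \<open>F\<close> from falling below its value at the origin on
the segments from the origin to the members of the sequence, and continuity carries this over to the whole ray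
through \<open>e\<close>. On a bounded superlevel set a maximizing sequence has a convergent subsequence. Vectors are functions, of
which \<open>F\<close> only sees the values on \<open>I\<close>, by continuity along constant sequences.\<close>

lemma concave_attains_max_if_unbounded_below_on_rays:
  fixes F :: "('i \<Rightarrow> real) \<Rightarrow> real"
  assumes I: "finite I"
    and concave: "\<And>s x y. 0 \<le> s \<Longrightarrow> s \<le> 1 \<Longrightarrow>
        (1 - s) * F x + s * F y \<le> F (\<lambda>i. (1 - s) * x i + s * y i)"
    and cont: "\<And>x l. (\<And>i. i \<in> I \<Longrightarrow> (\<lambda>n. x n i) \<longlonglongrightarrow> l i) \<Longrightarrow> (\<lambda>n. F (x n)) \<longlonglongrightarrow> F l"
    and rays: "\<And>d. \<exists>i\<in>I. d i \<noteq> 0 \<Longrightarrow> \<exists>s\<ge>0. F (\<lambda>i. s * d i) < F (\<lambda>_. 0)"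
  obtains l where "\<And>k. F k \<le> F l"
proof -
  let ?N = "\<lambda>k. \<Sum>i\<in>I. \<bar>k i\<bar>"
  have "\<exists>R. \<forall>k. F (\<lambda>_. 0) \<le> F k \<longrightarrow> ?N k \<le> R"
  proof (rule ccontr)
    assume "\<not> ?thesis"
    then have "\<exists>k. F (\<lambda>_. 0) \<le> F k \<and> real n < ?N k" for n :: nat
      by (simp add: not_le)
    then obtain k where k: "\<And>n. F (\<lambda>_. 0) \<le> F (k n)" "\<And>n. real n < ?N (k n)"
      by metis
    define d where "d = (\<lambda>n i. k n i / ?N (k n))"
    have Npos: "?N (k n) > 0" for n using k(2)[of n] by linarith
    have Nd: "?N (d n) = 1" for n
      using Npos[of n] by (simp add: d_def sum_divide_distrib[symmetric])
    have "bounded (range (\<lambda>n. d n i))" if "i \<in> I" for i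
    proof -
      have "\<bar>d n i\<bar> \<le> 1" for n
        using member_le_sum[of i I "\<lambda>i. \<bar>d n i\<bar>"] that I Nd[of n] by simp
      then show ?thesis by (auto simp: bounded_iff)
    qed
    then obtain r e where r: "strict_mono r" "\<And>i. i \<in> I \<Longrightarrow> (\<lambda>n. d (r n) i) \<longlonglongrightarrow> e i"
      using bounded_coordinates_convergent_subsequence[OF I, of d] by blast
    have "(\<lambda>n. ?N (d (r n))) \<longlonglongrightarrow> ?N e"
      by (intro tendsto_sum tendsto_rabs r(2))
    then have "?N e = 1" by (simp add: Nd LIMSEQ_const_iff)
    then have "\<exists>i\<in>I. e i \<noteq> 0"
      using sum.neutral[of I "\<lambda>i. \<bar>e i\<bar>"] by fastforce
    then obtain s where s: "0 \<le> s" "F (\<lambda>i. s * e i) < F (\<lambda>_. 0)"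
      using rays by blast
    \<comment> \<open>the point \<open>s * d n\<close> divides the segment from the origin to \<open>k n\<close> in the ratio given by \<open>q\<close>\<close>
    have "F (\<lambda>_. 0) \<le> F (\<lambda>i. s * d n i)" if "real n \<ge> s" for n
    proof -
      define q where "q = s / ?N (k n)"
      have q: "0 \<le> q" "q \<le> 1" using s(1) that k(2)[of n] Npos[of n] by (auto simp: q_def)
      have "F (\<lambda>_. 0) \<le> (1 - q) * F (\<lambda>_. 0) + q * F (k n)"
        using mult_left_mono[OF k(1)[of n] q(1)] by (simp add: algebra_simps)
      also have "\<dots> \<le> F (\<lambda>i. (1 - q) * 0 + q * k n i)" by (rule concave[OF q])
      also have "(\<lambda>i. (1 - q) * 0 + q * k n i) = (\<lambda>i. s * d n i)" by (simp add: q_def d_def)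
      finally show ?thesis .
    qed
    moreover have "s \<le> real (r n)" if "nat \<lceil>s\<rceil> \<le> n" for n
      using that seq_suble[OF r(1), of n] by linarith
    ultimately have "\<forall>\<^sub>F n in sequentially. F (\<lambda>_. 0) \<le> F (\<lambda>i. s * d (r n) i)"
      unfolding eventually_sequentially by blast
    moreover have "(\<lambda>n. F (\<lambda>i. s * d (r n) i)) \<longlonglongrightarrow> F (\<lambda>i. s * e i)"
      by (intro cont tendsto_mult tendsto_const r(2))
    ultimately have "F (\<lambda>_. 0) \<le> F (\<lambda>i. s * e i)"
      by (intro tendsto_lowerbound[OF _ _ sequentially_bot])
    with s(2) show False by simp
  qed
  then obtain R where R: "\<And>k. F (\<lambda>_. 0) \<le> F k \<Longrightarrow> ?N k \<le> R" by blast
  \<comment> \<open>extended reals provide a maximizing sequence before the supremum is known to be finite\<close>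
  define A where "A = (\<lambda>k. ereal (F k)) ` {k. F (\<lambda>_. 0) \<le> F k}"
  have "A \<noteq> {}" by (auto simp: A_def)
  then obtain f where f: "incseq f" "range f \<subseteq> A" "Sup A = (SUP n. f n)"
    using Sup_countable_SUP by blast
  then have "\<forall>n. \<exists>k. F (\<lambda>_. 0) \<le> F k \<and> f n = ereal (F k)" by (auto simp: A_def)
  then obtain k where k: "\<And>n. F (\<lambda>_. 0) \<le> F (k n)" "\<And>n. f n = ereal (F (k n))" by metis
  have "bounded (range (\<lambda>n. k n i))" if "i \<in> I" for i
  proof -
    have "\<bar>k n i\<bar> \<le> R" for n
      using member_le_sum[of i I "\<lambda>i. \<bar>k n i\<bar>"] that I R[OF k(1)[of n]] by simp
    then show ?thesis by (auto simp: bounded_iff)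
  qed
  then obtain r l where r: "strict_mono r" "\<And>i. i \<in> I \<Longrightarrow> (\<lambda>n. k (r n) i) \<longlonglongrightarrow> l i"
    using bounded_coordinates_convergent_subsequence[OF I, of k] by blast
  have "(\<lambda>n. f (r n)) \<longlonglongrightarrow> ereal (F l)"
    unfolding k(2) by (intro tendsto_ereal cont r(2))
  moreover have "(\<lambda>n. f (r n)) \<longlonglongrightarrow> Sup A"
    using LIMSEQ_subseq_LIMSEQ[OF LIMSEQ_SUP[OF f(1)] r(1)] by (simp add: f(3) o_def)
  ultimately have Sup: "Sup A = ereal (F l)" by (rule LIMSEQ_unique[rotated])
  have le: "F x \<le> F l" if "F (\<lambda>_. 0) \<le> F x" for x
    using Sup_upper[of "ereal (F x)" A] that unfolding Sup by (auto simp: A_def)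
  show thesis
  proof (rule that)
    fix x show "F x \<le> F l" using le[of x] le[of "\<lambda>_. 0"] by linarith
  qed
qed

section \<open>Auxiliary inequalities and the extended integral\<close>

text \<open>Young's inequality for the conjugate pair \<open>w ln w\<close>, \<open>exp (y - 1)\<close>. With \<open>z = y - 1 - ln w\<close> the gap between the
two sides is \<open>w * (exp z - 1 - z)\<close>, which vanishes only for \<open>z = 0\<close>.\<close>

lemma young_exp:
  fixes w y :: real
  assumes "0 \<le> w"
  shows "w * y \<le> w * ln w + exp (y - 1)"
    and "w * y = w * ln w + exp (y - 1) \<Longrightarrow> w = exp (y - 1)"
proof -
  have *: "w * ln w + exp (y - 1) - w * y = w * (exp z - 1 - z)" if "w > 0" "z = y - 1 - ln w" for z
  proof -
    have "y = 1 + ln w + z" "exp (y - 1) = w * exp z" using that by (auto simp: exp_diff)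
    then show ?thesis by (simp add: algebra_simps)
  qed
  show "w * y \<le> w * ln w + exp (y - 1)"
  proof (cases "w = 0")
    case False
    with assms have w: "w > 0" by simp
    have "0 \<le> w * (exp (y - 1 - ln w) - 1 - (y - 1 - ln w))"
      using w exp_ge_add_one_self[of "y - 1 - ln w"] by (intro mult_nonneg_nonneg) linarith+
    then show ?thesis using *[OF w refl] by linarith
  qed simp
  assume eq: "w * y = w * ln w + exp (y - 1)"
  then have "w \<noteq> 0" by auto
  with assms have w: "w > 0" by simp
  define z where "z = y - 1 - ln w"
  have "exp z - 1 - z = 0" using *[OF w z_def] eq w by simp
  then have "exp z = 1" using ln_eq_minus_one[of "exp z"] by simp
  then have "exp (ln w) = exp (y - 1)" by (simp add: z_def)
  then show "w = exp (y - 1)" using w by simp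
qed

text \<open>A second-order remainder that stays integrable after multiplication by the densities below. It replaces
differentiation under the integral in the first-order conditions.\<close>

lemma exp_le_quadratic: "exp (x::real) \<le> 1 + x + x\<^sup>2 * exp \<bar>x\<bar>"
proof -
  have up: "exp u - 1 \<le> u * exp u" for u :: real
    using mult_right_mono[OF exp_ge_add_one_self[of "- u"], of "exp u"]
    by (simp add: algebra_simps flip: exp_add)
  have "\<bar>exp x - 1\<bar> \<le> \<bar>x\<bar> * exp \<bar>x\<bar>"
  proof (cases "x \<ge> 0")
    case True then show ?thesis using up[of x] by simp
  next
    case False
    have "1 - exp x \<le> - x" using exp_ge_add_one_self[of x] by linarith
    also have "\<dots> \<le> - x * exp (- x)" using False by simp
    finally show ?thesis using False by simp
  qed
  then have "\<bar>x\<bar> * \<bar>exp x - 1\<bar> \<le> \<bar>x\<bar> * (\<bar>x\<bar> * exp \<bar>x\<bar>)" by (rule mult_left_mono) simp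
  then have "x * (exp x - 1) \<le> x\<^sup>2 * exp \<bar>x\<bar>"
    using abs_ge_self[of "x * (exp x - 1)"]
    by (simp add: abs_mult power2_eq_square flip: mult.assoc)
  then show ?thesis using up[of x] by (simp add: algebra_simps)
qed

lemma ext_integral_eq_integral:
  assumes "integrable M u"
  shows "ext_integral M u = ereal (\<integral>x. u x \<partial>M)"
proof -
  from assms obtain r q where "0 \<le> r" "0 \<le> q" "(\<integral>\<^sup>+x. ennreal (u x) \<partial>M) = ennreal r"
    "(\<integral>\<^sup>+x. ennreal (- u x) \<partial>M) = ennreal q" "(\<integral>x. u x \<partial>M) = r - q"
    by (rule integrableE)
  then show ?thesis by (simp add: ext_integral_def enn2ereal_ennreal)
qed

lemma ext_integral_eq_top:
  assumes "u \<in> borel_measurable M" "(\<integral>\<^sup>+x. ennreal (- u x) \<partial>M) < \<infinity>" "\<not> integrable M u"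
  shows "ext_integral M u = \<infinity>"
proof -
  have "(\<integral>\<^sup>+x. ennreal (u x) \<partial>M) = \<infinity>"
    using assms by (auto simp: real_integrable_def)
  moreover obtain q where "0 \<le> q" "(\<integral>\<^sup>+x. ennreal (- u x) \<partial>M) = ennreal q"
    using assms(2) by (metis ennreal_cases infinity_ennreal_def less_irrefl)
  ultimately show ?thesis by (simp add: ext_integral_def enn2ereal_ennreal)
qed

lemma zero_if_linear_le_quadratic:
  fixes x C :: real
  assumes le: "\<And>s. \<bar>s\<bar> \<le> 1 \<Longrightarrow> s * x \<le> s\<^sup>2 * C"
  shows "x = 0"
proof (rule ccontr)
  assume x: "x \<noteq> 0"
  define N where "N = \<bar>x\<bar> + \<bar>C\<bar> + 1"
  have N: "N > 0" "N > C" "\<bar>x\<bar> \<le> N" by (auto simp: N_def)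
  then have "x / N * x \<le> (x / N)\<^sup>2 * C" by (intro le) (simp add: abs_divide)
  then have "x\<^sup>2 * N \<le> x\<^sup>2 * C" using N by (simp add: field_simps power2_eq_square)
  then show False using x N by simp
qed

section \<open>Duality for entropy under finitely many moment constraints\<close>

text \<open>The monomials are abstracted to finitely many moment functions \<open>\<phi> i\<close> such that \<open>\<phi> i / a\<close> has exponential
moments of every order with respect to \<open>\<rho>\<close>. One condition on the sum of the absolute values covers all linear
combinations at once.\<close>

locale moment_duality =
  fixes M :: "'a measure" and I :: "'i set" and \<phi> :: "'i \<Rightarrow> 'a \<Rightarrow> real" and a \<rho> :: "'a \<Rightarrow> real"
  assumes finite_I: "finite I"
    and meas_\<phi>: "\<And>i. i \<in> I \<Longrightarrow> \<phi> i \<in> borel_measurable M"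
    and meas_a [measurable]: "a \<in> borel_measurable M"
    and meas_\<rho> [measurable]: "\<rho> \<in> borel_measurable M"
    and a_pos: "AE t in M. 0 < a t"
    and \<rho>_pos: "AE t in M. 0 < \<rho> t"
    and exp_integrable: "\<And>c. integrable M (\<lambda>t. exp (c * ((\<Sum>i\<in>I. \<bar>\<phi> i t\<bar>) / a t)) * \<rho> t)"
begin

text \<open>The common majorant: every exponent is bounded by a multiple of it, with the factor depending on the
coefficients only.\<close>

definition weight :: "'a \<Rightarrow> real" where
  "weight t = (\<Sum>i\<in>I. \<bar>\<phi> i t\<bar>) / a t"

definition exponent :: "('i \<Rightarrow> real) \<Rightarrow> 'a \<Rightarrow> real" where
  "exponent l t = (\<Sum>i\<in>I. l i * \<phi> i t / a t)"

text \<open>Where \<open>a\<close> and \<open>\<rho>\<close> are positive, the unique \<open>f\<close> with \<open>a f / \<rho> = exp (y - 1)\<close> for the exponent \<open>y\<close> of \<open>l\<close>,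
that is, with equality in Young's inequality.\<close>

definition gibbs :: "('i \<Rightarrow> real) \<Rightarrow> 'a \<Rightarrow> real" where
  "gibbs l t = inverse (a t) * \<rho> t * exp (exponent l t - 1)"

definition dual :: "('i \<Rightarrow> real) \<Rightarrow> ('i \<Rightarrow> real) \<Rightarrow> real" where
  "dual g l = (\<Sum>i\<in>I. g i * l i) - (\<integral>t. exp (exponent l t - 1) * \<rho> t \<partial>M)"

text \<open>The integrand of the negative entropy, which is to be minimized.\<close>

definition primal_integrand :: "('a \<Rightarrow> real) \<Rightarrow> 'a \<Rightarrow> real" where
  "primal_integrand f t = (a t * f t / \<rho> t * ln (a t * f t / \<rho> t)) * \<rho> t"

definition feasible :: "('i \<Rightarrow> real) \<Rightarrow> ('a \<Rightarrow> real) \<Rightarrow> bool" where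
  "feasible g f \<longleftrightarrow> f \<in> borel_measurable M \<and> (AE t in M. 0 \<le> f t) \<and>
     (\<forall>i\<in>I. has_bochner_integral M (\<lambda>t. \<phi> i t * f t) (g i))"

lemma meas_weight [measurable]: "weight \<in> borel_measurable M"
  unfolding weight_def[abs_def]
  by (intro borel_measurable_divide borel_measurable_sum borel_measurable_abs meas_\<phi> meas_a)

lemma meas_exponent [measurable]: "exponent l \<in> borel_measurable M"
  unfolding exponent_def[abs_def]
  by (intro borel_measurable_divide borel_measurable_sum borel_measurable_times borel_measurable_const meas_\<phi> meas_a)

lemma meas_gibbs [measurable]: "gibbs l \<in> borel_measurable M"
  unfolding gibbs_def[abs_def] by measurable

lemma abs_exponent_le:
  assumes "0 < a t" and l: "\<And>i. i \<in> I \<Longrightarrow> \<bar>l i\<bar> \<le> c"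
  shows "\<bar>exponent l t\<bar> \<le> c * weight t"
proof -
  have "\<bar>exponent l t\<bar> \<le> (\<Sum>i\<in>I. \<bar>l i * \<phi> i t / a t\<bar>)" unfolding exponent_def by (rule sum_abs)
  also have "\<dots> \<le> (\<Sum>i\<in>I. c * (\<bar>\<phi> i t\<bar> / a t))"
  proof (rule sum_mono)
    fix i assume "i \<in> I"
    then show "\<bar>l i * \<phi> i t / a t\<bar> \<le> c * (\<bar>\<phi> i t\<bar> / a t)"
      using assms by (auto simp: abs_mult divide_simps mult_right_mono)
  qed
  also have "\<dots> = c * weight t" by (simp add: weight_def sum_distrib_left sum_divide_distrib)
  finally show ?thesis .
qed

lemma coefficients_bounded:
  obtains c where "0 \<le> c" "\<And>i. i \<in> I \<Longrightarrow> \<bar>l i :: real\<bar> \<le> c"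
proof
  show "0 \<le> (\<Sum>i\<in>I. \<bar>l i\<bar>)" by (simp add: sum_nonneg)
  show "\<bar>l i\<bar> \<le> (\<Sum>i\<in>I. \<bar>l i\<bar>)" if "i \<in> I" for i
    using member_le_sum[of i I "\<lambda>i. \<bar>l i\<bar>"] that finite_I by simp
qed

lemma exp_weight_integrable: "integrable M (\<lambda>t. exp (c * weight t) * \<rho> t)"
  using exp_integrable by (simp add: weight_def)

lemma integrable_if_exp_bounded:
  assumes [measurable]: "h \<in> borel_measurable M"
    and le: "\<And>t. 0 < a t \<Longrightarrow> \<bar>h t\<bar> \<le> C * exp (c * weight t)"
  shows "integrable M (\<lambda>t. h t * \<rho> t)"
proof (rule Bochner_Integration.integrable_bound)
  show "integrable M (\<lambda>t. C * (exp (c * weight t) * \<rho> t))"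
    by (intro integrable_mult_right exp_weight_integrable)
  show "AE t in M. norm (h t * \<rho> t) \<le> norm (C * (exp (c * weight t) * \<rho> t))"
    using a_pos \<rho>_pos
  proof eventually_elim
    case (elim t)
    have "\<bar>h t\<bar> * \<rho> t \<le> C * exp (c * weight t) * \<rho> t"
      using le elim by (intro mult_right_mono) auto
    also have "\<dots> \<le> \<bar>C * exp (c * weight t) * \<rho> t\<bar>" by (rule abs_ge_self)
    finally show ?case using elim by (simp add: abs_mult mult.assoc)
  qed
qed measurable

lemma exp_exponent_integrable: "integrable M (\<lambda>t. exp (exponent l t - 1) * \<rho> t)"
proof -
  obtain c where "\<And>i. i \<in> I \<Longrightarrow> \<bar>l i\<bar> \<le> c" using coefficients_bounded[of l] by blast
  then have "\<bar>exp (exponent l t - 1)\<bar> \<le> 1 * exp (c * weight t)" if "0 < a t" for t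
    using abs_exponent_le[OF that, of l c] by simp
  then show ?thesis by (intro integrable_if_exp_bounded) measurable
qed

lemma exponent_affine:
  "exponent (\<lambda>i. r * x i + s * y i) t = r * exponent x t + s * exponent y t"
  by (simp add: exponent_def sum_distrib_left sum.distrib[symmetric] algebra_simps add_divide_distrib)

lemma exponent_times_a: "a t \<noteq> 0 \<Longrightarrow> exponent l t * a t = (\<Sum>i\<in>I. l i * \<phi> i t)"
  by (simp add: exponent_def sum_distrib_right)

lemma exponent_cong: "(\<And>i. i \<in> I \<Longrightarrow> x i = y i) \<Longrightarrow> exponent x = exponent y"
  by (auto simp: exponent_def intro!: sum.cong)

lemma dual_cong: "(\<And>i. i \<in> I \<Longrightarrow> x i = y i) \<Longrightarrow> dual g x = dual g y"
  unfolding dual_def by (subst exponent_cong[of x y]) (auto intro!: sum.cong)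

lemma feasible_pairing:
  assumes "feasible g f"
  shows "has_bochner_integral M (\<lambda>t. (\<Sum>i\<in>I. l i * \<phi> i t) * f t) (\<Sum>i\<in>I. g i * l i)"
proof -
  have "has_bochner_integral M (\<lambda>t. \<Sum>i\<in>I. l i * (\<phi> i t * f t)) (\<Sum>i\<in>I. l i * g i)"
    using assms by (intro has_bochner_integral_sum has_bochner_integral_mult_right) (auto simp: feasible_def)
  then show ?thesis by (simp add: sum_distrib_right mult.assoc mult.commute[of "g _"])
qed

text \<open>Young's inequality in the form that is integrated below: the product \<open>w y \<rho>\<close> equals
\<open>(\<Sum>i\<in>I. l i * \<phi> i t) * f t\<close>, because \<open>a\<close> and \<open>\<rho>\<close> cancel.\<close>

lemma primal_integrand_ge:
  assumes "0 < a t" "0 < \<rho> t" "0 \<le> f t"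
  shows "(\<Sum>i\<in>I. l i * \<phi> i t) * f t - exp (exponent l t - 1) * \<rho> t \<le> primal_integrand f t"
    and "(\<Sum>i\<in>I. l i * \<phi> i t) * f t - exp (exponent l t - 1) * \<rho> t = primal_integrand f t \<Longrightarrow>
         f t = gibbs l t"
proof -
  define w where "w = a t * f t / \<rho> t"
  have w: "0 \<le> w" using assms by (simp add: w_def)
  have eq: "(\<Sum>i\<in>I. l i * \<phi> i t) * f t = (w * exponent l t) * \<rho> t"
    using assms exponent_times_a[of t l] by (simp add: w_def mult_ac)
  have pr: "primal_integrand f t = (w * ln w) * \<rho> t" by (simp add: primal_integrand_def w_def)
  show "(\<Sum>i\<in>I. l i * \<phi> i t) * f t - exp (exponent l t - 1) * \<rho> t \<le> primal_integrand f t"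
    using mult_right_mono[OF young_exp(1)[OF w, of "exponent l t"], of "\<rho> t"] assms
    unfolding eq pr by (simp add: algebra_simps)
  assume "(\<Sum>i\<in>I. l i * \<phi> i t) * f t - exp (exponent l t - 1) * \<rho> t = primal_integrand f t"
  then have "(w * exponent l t) * \<rho> t = (w * ln w + exp (exponent l t - 1)) * \<rho> t"
    unfolding eq pr by (simp add: algebra_simps)
  then have "w = exp (exponent l t - 1)" using assms young_exp(2)[OF w] by simp
  then show "f t = gibbs l t" using assms by (simp add: w_def gibbs_def field_simps)
qed

text \<open>Young's inequality at \<open>l = 0\<close> reads \<open>- w ln w \<le> exp (- 1)\<close>, and \<open>\<rho>\<close> is integrable.\<close>

lemma primal_negative_part_finite:
  assumes "AE t in M. 0 \<le> f t"
  shows "(\<integral>\<^sup>+t. ennreal (- primal_integrand f t) \<partial>M) < \<infinity>"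
proof -
  have "(\<integral>\<^sup>+t. ennreal (- primal_integrand f t) \<partial>M) \<le> (\<integral>\<^sup>+t. ennreal (exp (exponent (\<lambda>_. 0) t - 1) * \<rho> t) \<partial>M)"
  proof (rule nn_integral_mono_AE)
    show "AE t in M. ennreal (- primal_integrand f t) \<le> ennreal (exp (exponent (\<lambda>_. 0) t - 1) * \<rho> t)"
      using a_pos \<rho>_pos assms
    proof eventually_elim
      case (elim t)
      then show ?case
        using primal_integrand_ge(1)[of t f "\<lambda>_. 0"] by (intro ennreal_leI) simp
    qed
  qed
  also have "\<dots> < \<infinity>"
    using exp_exponent_integrable[of "\<lambda>_. 0"] by (simp add: real_integrable_def less_top)
  finally show ?thesis .
qed

lemma primal_gt_minus_infinity:
  assumes "AE t in M. 0 \<le> f t"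
  shows "- \<infinity> < ext_integral M (primal_integrand f)"
proof -
  obtain q where "0 \<le> q" "(\<integral>\<^sup>+x. ennreal (- primal_integrand f x) \<partial>M) = ennreal q"
    using primal_negative_part_finite[OF assms] by (metis ennreal_cases infinity_ennreal_def less_irrefl)
  then show ?thesis
    using enn2ereal_nonneg[of "\<integral>\<^sup>+x. ennreal (primal_integrand f x) \<partial>M"]
    by (cases "enn2ereal (\<integral>\<^sup>+x. ennreal (primal_integrand f x) \<partial>M)")
       (auto simp: ext_integral_def enn2ereal_ennreal)
qed

text \<open>The integral of the lower bound given by Young's inequality is the dual value. If the primal integrand is not
integrable, its integral is \<open>\<infinity>\<close>, since the negative part is finite, so the equality case concerns
integrable integrands only. Two ordered integrable functions with equal integrals agree almost everywhere, which
puts Young's inequality into its equality case.\<close>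

lemma weak_duality:
  assumes f: "feasible g f"
  shows "ereal (dual g l) \<le> ext_integral M (primal_integrand f)"
    and "ext_integral M (primal_integrand f) = ereal (dual g l) \<Longrightarrow> AE t in M. f t = gibbs l t"
proof -
  have [measurable]: "f \<in> borel_measurable M" and f0: "AE t in M. 0 \<le> f t"
    using f by (auto simp: feasible_def)
  have meas: "primal_integrand f \<in> borel_measurable M"
    unfolding primal_integrand_def[abs_def] by measurable
  define lower where "lower = (\<lambda>t. (\<Sum>i\<in>I. l i * \<phi> i t) * f t - exp (exponent l t - 1) * \<rho> t)"
  have "has_bochner_integral M lower (dual g l)"
    unfolding lower_def dual_def
    by (intro has_bochner_integral_diff feasible_pairing f has_bochner_integral_integrable exp_exponent_integrable)
  then have lower: "integrable M lower" "(\<integral>t. lower t \<partial>M) = dual g l"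
    by (simp_all add: has_bochner_integral_iff)
  have ge: "AE t in M. lower t \<le> primal_integrand f t"
    using a_pos \<rho>_pos f0 by eventually_elim (unfold lower_def, rule primal_integrand_ge(1))
  have top: "ext_integral M (primal_integrand f) = \<infinity>" if "\<not> integrable M (primal_integrand f)"
    using ext_integral_eq_top[OF meas primal_negative_part_finite[OF f0] that] .
  show "ereal (dual g l) \<le> ext_integral M (primal_integrand f)"
  proof (cases "integrable M (primal_integrand f)")
    case True
    then show ?thesis
      using integral_mono_AE[OF lower(1) True ge] by (simp add: ext_integral_eq_integral lower(2))
  qed (simp add: top)
  assume eq: "ext_integral M (primal_integrand f) = ereal (dual g l)"
  then have int: "integrable M (primal_integrand f)" using top by force
  then have "(\<integral>t. primal_integrand f t - lower t \<partial>M) = 0"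
    using eq lower by (simp add: ext_integral_eq_integral)
  then have "AE t in M. primal_integrand f t - lower t = 0"
    using int lower(1) ge by (subst (asm) integral_nonneg_eq_0_iff_AE) auto
  then show "AE t in M. f t = gibbs l t"
    using a_pos \<rho>_pos f0
  proof eventually_elim
    case (elim t)
    then show ?case by (intro primal_integrand_ge(2)) (auto simp: lower_def)
  qed
qed

lemma gibbs_nonneg: "AE t in M. 0 \<le> gibbs l t"
  using a_pos \<rho>_pos by eventually_elim (simp add: gibbs_def)

text \<open>The density realizes equality in Young's inequality at almost every point, so the lower bound integrated
in weak duality is the primal integrand itself.\<close>

lemma strong_duality:
  assumes "feasible g (gibbs l)"
  shows "ext_integral M (primal_integrand (gibbs l)) = ereal (dual g l)"
proof -
  have "AE t in M. (\<Sum>i\<in>I. l i * \<phi> i t) * gibbs l t - exp (exponent l t - 1) * \<rho> t = primal_integrand (gibbs l) t"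
    using a_pos \<rho>_pos
  proof eventually_elim
    case (elim t)
    then have "a t * gibbs l t / \<rho> t = exp (exponent l t - 1)" by (simp add: gibbs_def)
    then have "primal_integrand (gibbs l) t = exp (exponent l t - 1) * (exponent l t - 1) * \<rho> t"
      by (simp add: primal_integrand_def)
    moreover have "(\<Sum>i\<in>I. l i * \<phi> i t) * gibbs l t = exponent l t * exp (exponent l t - 1) * \<rho> t"
      using elim by (simp add: exponent_times_a[symmetric] gibbs_def)
    ultimately show ?case by (simp add: algebra_simps)
  qed
  moreover have "has_bochner_integral M
      (\<lambda>t. (\<Sum>i\<in>I. l i * \<phi> i t) * gibbs l t - exp (exponent l t - 1) * \<rho> t) (dual g l)"
    unfolding dual_def
    by (intro has_bochner_integral_diff feasible_pairing assms has_bochner_integral_integrable exp_exponent_integrable)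
  moreover have "primal_integrand (gibbs l) \<in> borel_measurable M"
    unfolding primal_integrand_def[abs_def] by measurable
  ultimately have "has_bochner_integral M (primal_integrand (gibbs l)) (dual g l)"
    using has_bochner_integral_cong_AE borel_measurable_has_bochner_integral by blast
  then show ?thesis by (simp add: ext_integral_eq_integral has_bochner_integral_iff)
qed

lemma dual_affine_eq:
  "dual g (\<lambda>i. x i + s * y i) =
     (\<Sum>i\<in>I. g i * x i) + s * (\<Sum>i\<in>I. g i * y i) - (\<integral>t. exp (exponent x t + s * exponent y t - 1) * \<rho> t \<partial>M)"
  using exponent_affine[of 1 x s y]
  by (simp add: dual_def sum.distrib sum_distrib_left algebra_simps)

lemma abs_\<phi>_div_a_le_weight:
  assumes "i \<in> I" "0 < a t"
  shows "\<bar>\<phi> i t / a t\<bar> \<le> weight t"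
  using assms member_le_sum[of i I "\<lambda>i. \<bar>\<phi> i t\<bar>"] finite_I
  by (simp add: weight_def divide_right_mono)

text \<open>The first-order conditions. Along the \<open>i\<close>-th coordinate, with \<open>q = \<phi> i / a\<close>, the quadratic upper bound for \<open>exp (s q)\<close>
shows that the dual gains at least \<open>s * (g i - G) - s\<^sup>2 * C\<close>, where \<open>G\<close> is the \<open>i\<close>-th moment of the density. At a
maximizer this gain is nonpositive for all small \<open>s\<close> of either sign, so \<open>g i = G\<close>.\<close>

lemma gibbs_feasible_if_dual_max:
  assumes max: "\<And>k. dual g k \<le> dual g l"
  shows "feasible g (gibbs l)"
proof -
  have "has_bochner_integral M (\<lambda>t. \<phi> i t * gibbs l t) (g i)" if i: "i \<in> I" for i
  proof -
    have [measurable]: "\<phi> i \<in> borel_measurable M" using meas_\<phi>[OF i] .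
    define q where "q = (\<lambda>t. \<phi> i t / a t)"
    have [measurable]: "q \<in> borel_measurable M" unfolding q_def by measurable
    define E where "E = (\<lambda>t. exp (exponent l t - 1))"
    have [measurable]: "E \<in> borel_measurable M" unfolding E_def by measurable
    obtain c where c: "0 \<le> c" "\<And>i. i \<in> I \<Longrightarrow> \<bar>l i\<bar> \<le> c" using coefficients_bounded[of l] by blast
    have E_le: "\<bar>E t\<bar> \<le> exp (c * weight t)" if "0 < a t" for t
      using abs_exponent_le[OF that, of l c] c(2) by (simp add: E_def)
    have q_weight: "\<bar>q t\<bar> \<le> weight t" if "0 < a t" for t
      unfolding q_def using abs_\<phi>_div_a_le_weight[OF i that] .
    \<comment> \<open>polynomial factors in \<open>q\<close> are absorbed by raising the multiple of \<open>weight\<close> in the exponent\<close>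
    have q_le: "\<bar>q t\<bar> \<le> exp (weight t)" if "0 < a t" for t
      using q_weight[OF that] exp_ge_add_one_self[of "weight t"] by linarith
    have int1: "integrable M (\<lambda>t. E t * q t * \<rho> t)"
    proof (rule integrable_if_exp_bounded)
      fix t assume t: "0 < a t"
      have "\<bar>E t * q t\<bar> \<le> exp (c * weight t) * exp (weight t)"
        unfolding abs_mult using E_le[OF t] q_le[OF t] by (intro mult_mono) auto
      then show "\<bar>E t * q t\<bar> \<le> 1 * exp ((c + 1) * weight t)"
        by (simp add: algebra_simps exp_add)
    qed measurable
    have int2: "integrable M (\<lambda>t. E t * ((q t)\<^sup>2 * exp \<bar>q t\<bar>) * \<rho> t)"
    proof (rule integrable_if_exp_bounded)
      fix t assume t: "0 < a t"
      have "(q t)\<^sup>2 \<le> (exp (weight t))\<^sup>2" using q_le[OF t] by (simp add: abs_le_square_iff[symmetric])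
      then have "(q t)\<^sup>2 * exp \<bar>q t\<bar> \<le> (exp (weight t))\<^sup>2 * exp (weight t)"
        using q_weight[OF t] by (intro mult_mono) auto
      then have "\<bar>E t\<bar> * ((q t)\<^sup>2 * exp \<bar>q t\<bar>) \<le> exp (c * weight t) * ((exp (weight t))\<^sup>2 * exp (weight t))"
        by (rule mult_mono[OF E_le[OF t]]) auto
      also have "\<dots> = 1 * exp ((c + 3) * weight t)"
        by (simp add: power2_eq_square algebra_simps flip: exp_add)
      finally show "\<bar>E t * ((q t)\<^sup>2 * exp \<bar>q t\<bar>)\<bar> \<le> 1 * exp ((c + 3) * weight t)"
        by (simp add: abs_mult)
    qed measurable
    define G C where "G = (\<integral>t. E t * q t * \<rho> t \<partial>M)" and "C = (\<integral>t. E t * ((q t)\<^sup>2 * exp \<bar>q t\<bar>) * \<rho> t \<partial>M)"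
    define Z where "Z = (\<integral>t. E t * \<rho> t \<partial>M)"
    have int0: "integrable M (\<lambda>t. E t * \<rho> t)" unfolding E_def by (rule exp_exponent_integrable)
    let ?e = "\<lambda>j. if j = i then 1 else 0 :: real"
    have e: "exponent ?e t = q t" for t
    proof -
      have "exponent ?e t = (\<Sum>j\<in>I. if j = i then \<phi> i t / a t else 0)"
        unfolding exponent_def by (intro sum.cong) auto
      then show ?thesis using i finite_I by (simp add: q_def)
    qed
    have ge: "(\<Sum>j\<in>I. g j * ?e j) = g i"
    proof -
      have "(\<Sum>j\<in>I. g j * ?e j) = (\<Sum>j\<in>I. if j = i then g i else 0)" by (intro sum.cong) auto
      then show ?thesis using i finite_I by simp
    qed
    have key: "s * (g i - G) \<le> s\<^sup>2 * C" if s: "\<bar>s\<bar> \<le> 1" for s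
    proof -
      have "(\<integral>t. exp (exponent l t + s * exponent ?e t - 1) * \<rho> t \<partial>M)
          \<le> (\<integral>t. E t * \<rho> t + s * (E t * q t * \<rho> t) + s\<^sup>2 * (E t * ((q t)\<^sup>2 * exp \<bar>q t\<bar>) * \<rho> t) \<partial>M)"
      proof (rule integral_mono_AE)
        show "integrable M (\<lambda>t. exp (exponent l t + s * exponent ?e t - 1) * \<rho> t)"
          using exp_exponent_integrable[of "\<lambda>j. 1 * l j + s * ?e j"] unfolding exponent_affine by simp
        show "integrable M (\<lambda>t. E t * \<rho> t + s * (E t * q t * \<rho> t) + s\<^sup>2 * (E t * ((q t)\<^sup>2 * exp \<bar>q t\<bar>) * \<rho> t))"
          using int0 int1 int2 by simp
        show "AE t in M. exp (exponent l t + s * exponent ?e t - 1) * \<rho> t \<le>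
            E t * \<rho> t + s * (E t * q t * \<rho> t) + s\<^sup>2 * (E t * ((q t)\<^sup>2 * exp \<bar>q t\<bar>) * \<rho> t)"
          using \<rho>_pos
        proof eventually_elim
          case (elim t)
          have "exp (s * q t) \<le> 1 + s * q t + (s * q t)\<^sup>2 * exp \<bar>s * q t\<bar>" by (rule exp_le_quadratic)
          also have "\<dots> \<le> 1 + s * q t + (s * q t)\<^sup>2 * exp \<bar>q t\<bar>"
            using mult_right_mono[OF s, of "\<bar>q t\<bar>"] by (intro add_left_mono mult_left_mono) (auto simp: abs_mult)
          finally have "E t * \<rho> t * exp (s * q t) \<le> E t * \<rho> t * (1 + s * q t + (s * q t)\<^sup>2 * exp \<bar>q t\<bar>)"
            using elim by (intro mult_left_mono) (auto simp: E_def)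
          moreover have "exp (exponent l t + s * exponent ?e t - 1) = E t * exp (s * q t)"
            unfolding E_def e by (simp flip: exp_add add: algebra_simps)
          ultimately show ?case by (simp add: algebra_simps power2_eq_square)
        qed
      qed
      also have "\<dots> = Z + s * G + s\<^sup>2 * C"
        using int0 int1 int2 by (simp add: Z_def G_def C_def)
      finally have "dual g l + s * (g i - G) - s\<^sup>2 * C \<le> dual g (\<lambda>j. l j + s * ?e j)"
        unfolding dual_affine_eq ge by (simp add: dual_def Z_def E_def algebra_simps)
      then show ?thesis using max[of "\<lambda>j. l j + s * ?e j"] by linarith
    qed
    have "g i - G = 0" using key by (rule zero_if_linear_le_quadratic)
    moreover have "(\<lambda>t. \<phi> i t * gibbs l t) = (\<lambda>t. E t * q t * \<rho> t)"
      by (auto simp: gibbs_def E_def q_def divide_inverse)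
    ultimately show ?thesis using int1 by (simp add: has_bochner_integral_iff G_def)
  qed
  then show ?thesis using gibbs_nonneg by (simp add: feasible_def)
qed

lemma dual_concave:
  assumes s: "0 \<le> s" "s \<le> 1"
  shows "(1 - s) * dual g x + s * dual g y \<le> dual g (\<lambda>i. (1 - s) * x i + s * y i)"
proof -
  let ?Z = "\<lambda>l. \<integral>t. exp (exponent l t - 1) * \<rho> t \<partial>M"
  let ?z = "\<lambda>i. (1 - s) * x i + s * y i"
  have "?Z ?z \<le> (\<integral>t. (1 - s) * (exp (exponent x t - 1) * \<rho> t) + s * (exp (exponent y t - 1) * \<rho> t) \<partial>M)"
  proof (rule integral_mono_AE)
    show "AE t in M. exp (exponent ?z t - 1) * \<rho> t
        \<le> (1 - s) * (exp (exponent x t - 1) * \<rho> t) + s * (exp (exponent y t - 1) * \<rho> t)"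
      using \<rho>_pos
    proof eventually_elim
      case (elim t)
      have "exponent ?z t - 1 = (1 - s) *\<^sub>R (exponent x t - 1) + s *\<^sub>R (exponent y t - 1)"
        unfolding exponent_affine by (simp add: algebra_simps)
      then have "exp (exponent ?z t - 1) \<le> (1 - s) * exp (exponent x t - 1) + s * exp (exponent y t - 1)"
        using convex_onD[OF exp_convex s, of "exponent x t - 1" "exponent y t - 1"] by simp
      from mult_right_mono[OF this, of "\<rho> t"] show ?case using elim by (simp add: algebra_simps)
    qed
  qed (intro exp_exponent_integrable Bochner_Integration.integrable_add integrable_mult_right)+
  also have "\<dots> = (1 - s) * ?Z x + s * ?Z y"
    by (simp add: exp_exponent_integrable)
  finally have "?Z ?z \<le> (1 - s) * ?Z x + s * ?Z y" .
  moreover have "(\<Sum>i\<in>I. g i * ?z i) = (1 - s) * (\<Sum>i\<in>I. g i * x i) + s * (\<Sum>i\<in>I. g i * y i)"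
    by (simp add: sum_distrib_left sum.distrib[symmetric] mult_ac distrib_left)
  ultimately show ?thesis
    unfolding dual_def right_diff_distrib by linarith
qed

lemma dual_continuous:
  assumes lim: "\<And>i. i \<in> I \<Longrightarrow> (\<lambda>n. x n i) \<longlonglongrightarrow> l i"
  shows "(\<lambda>n. dual g (x n)) \<longlonglongrightarrow> dual g l"
proof -
  have "\<forall>i\<in>I. \<exists>B. \<forall>n. \<bar>x n i\<bar> \<le> B"
    using lim by (metis Bseq_def convergentI convergent_imp_Bseq real_norm_def)
  then obtain B where B: "\<And>i n. i \<in> I \<Longrightarrow> \<bar>x n i\<bar> \<le> B i" by metis
  define c where "c = (\<Sum>i\<in>I. \<bar>B i\<bar>)"
  have c: "\<bar>x n i\<bar> \<le> c" if "i \<in> I" for i n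
    using B[OF that, of n] member_le_sum[of i I "\<lambda>i. \<bar>B i\<bar>"] that finite_I by (simp add: c_def)
  have "(\<lambda>n. \<integral>t. exp (exponent (x n) t - 1) * \<rho> t \<partial>M) \<longlonglongrightarrow> (\<integral>t. exp (exponent l t - 1) * \<rho> t \<partial>M)"
  proof (rule integral_dominated_convergence)
    show "integrable M (\<lambda>t. exp (c * weight t) * \<rho> t)" by (rule exp_weight_integrable)
    show "AE t in M. norm (exp (exponent (x n) t - 1) * \<rho> t) \<le> exp (c * weight t) * \<rho> t" for n
      using a_pos \<rho>_pos
    proof eventually_elim
      case (elim t)
      then show ?case
        using abs_exponent_le[OF elim(1), of "x n" c] c by (simp add: abs_mult)
    qed
    show "AE t in M. (\<lambda>n. exp (exponent (x n) t - 1) * \<rho> t) \<longlonglongrightarrow> exp (exponent l t - 1) * \<rho> t"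
      unfolding exponent_def divide_inverse by (intro AE_I2 tendsto_intros lim)
  qed measurable
  then show ?thesis unfolding dual_def by (intro tendsto_intros lim)
qed

end

text \<open>The moment functions are linearly independent in the strong sense that nontrivial combinations vanish only on a
null set. For monomials this is the negligibility of zero sets of polynomials; it makes
nonpositive nontrivial combinations negative almost everywhere, and it separates the multipliers.\<close>

locale independent_moment_duality = moment_duality +
  assumes independent: "\<And>d. \<exists>i\<in>I. d i \<noteq> 0 \<Longrightarrow> AE t in M. (\<Sum>i\<in>I. d i * \<phi> i t) \<noteq> 0"
begin

text \<open>Let \<open>G = \<integral> p f\<close> be the slope of the linear term on the ray. If \<open>G < 0\<close>, the linear term alone suffices. If
\<open>G \<ge> 0\<close>, then \<open>p\<close> must be positive on a set of positive measure: otherwise \<open>p < 0\<close> almost everywhere, so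
\<open>p f \<le> 0\<close> has integral \<open>G = 0\<close>, so \<open>f = 0\<close>, although some moment of \<open>f\<close> is nonzero. The exponential term is
then bounded below by a positive multiple of \<open>s\<^sup>2\<close>, by the Taylor bound \<open>x\<^sup>2 / 2 \<le> exp x\<close> for \<open>x \<ge> 0\<close>.\<close>

lemma dual_decreases_on_rays:
  assumes f: "feasible g f" and g: "\<exists>i\<in>I. g i \<noteq> 0" and d: "\<exists>i\<in>I. d i \<noteq> 0"
  shows "\<exists>s\<ge>0. dual g (\<lambda>i. s * d i) < dual g (\<lambda>_. 0)"
proof -
  let ?p = "\<lambda>t. \<Sum>i\<in>I. d i * \<phi> i t"
  define G where "G = (\<Sum>i\<in>I. g i * d i)"
  define B where "B = \<bar>dual g (\<lambda>_. 0)\<bar> + 1"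
  have B: "B > 0" "- B < dual g (\<lambda>_. 0)" by (auto simp: B_def)
  have dual: "dual g (\<lambda>i. s * d i) = s * G - (\<integral>t. exp (s * exponent d t - 1) * \<rho> t \<partial>M)" for s
    using dual_affine_eq[of g "\<lambda>_. 0" s d] by (simp add: G_def exponent_def)
  have int: "integrable M (\<lambda>t. exp (s * exponent d t - 1) * \<rho> t)" for s
    using exp_exponent_integrable[of "\<lambda>i. 0 * d i + s * d i"] unfolding exponent_affine by simp
  show ?thesis
  proof (cases "G < 0")
    case True
    \<comment> \<open>the slope is negative: this parameter brings the linear term down to \<open>- B\<close>\<close>
    define s where "s = B / (- G)"
    have s: "0 \<le> s" "s * G = - B" using True B by (auto simp: s_def field_simps)
    have "AE t in M. 0 \<le> exp (s * exponent d t - 1) * \<rho> t"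
      using \<rho>_pos by eventually_elim simp
    then have "0 \<le> (\<integral>t. exp (s * exponent d t - 1) * \<rho> t \<partial>M)"
      by (rule integral_nonneg_AE)
    then have "dual g (\<lambda>i. s * d i) \<le> - B" unfolding dual s by simp
    then show ?thesis using s B by (intro exI[of _ s]) auto
  next
    case False
    define q where "q = (\<lambda>t. (max 0 (exponent d t))\<^sup>2)"
    have [measurable]: "q \<in> borel_measurable M" unfolding q_def by measurable
    define K where "K = (\<integral>t. exp (- 1) / 2 * (q t * \<rho> t) \<partial>M)"
    have q_le: "s\<^sup>2 * (exp (- 1) / 2 * q t) \<le> exp (s * exponent d t - 1)" if "0 \<le> s" for s t
    proof (cases "exponent d t \<ge> 0")
      case True
      then have "(s * exponent d t)\<^sup>2 / 2 \<le> exp (s * exponent d t)"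
        using exp_lower_Taylor_quadratic[of "s * exponent d t"] that
          mult_nonneg_nonneg[OF that True] by linarith
      then have "exp (- 1) * ((s * exponent d t)\<^sup>2 / 2) \<le> exp (- 1) * exp (s * exponent d t)"
        by (rule mult_left_mono) simp
      then show ?thesis using True by (simp add: q_def power_mult_distrib mult_ac flip: exp_add)
    qed (simp add: q_def)
    have int_q: "integrable M (\<lambda>t. exp (- 1) / 2 * (q t * \<rho> t))"
    proof (rule Bochner_Integration.integrable_bound[OF int[of 1]])
      show "AE t in M. norm (exp (- 1) / 2 * (q t * \<rho> t)) \<le> norm (exp (1 * exponent d t - 1) * \<rho> t)"
        using \<rho>_pos
      proof eventually_elim
        case (elim t)
        then show ?case
          using mult_right_mono[OF q_le[of 1 t], of "\<rho> t"] by (simp add: abs_mult q_def)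
      qed
    qed measurable
    have q_nonneg: "AE t in M. 0 \<le> exp (- 1) / 2 * (q t * \<rho> t)"
      using \<rho>_pos by eventually_elim (simp add: q_def)
    then have "K \<ge> 0" unfolding K_def by (rule integral_nonneg_AE)
    moreover have "K \<noteq> 0"
    proof
      assume "K = 0"
      then have "AE t in M. exp (- 1) / 2 * (q t * \<rho> t) = 0"
        unfolding K_def integral_nonneg_eq_0_iff_AE[OF int_q q_nonneg] .
      then have neg: "AE t in M. ?p t < 0"
        using a_pos \<rho>_pos independent[OF d]
      proof eventually_elim
        case (elim t)
        then have "max 0 (exponent d t) = 0" by (simp add: q_def)
        then have "exponent d t \<le> 0" by linarith
        then have "?p t \<le> 0" using elim exponent_times_a[of t d, symmetric] by (simp add: mult_nonpos_nonneg)
        then show ?case using elim by simp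
      qed
      have pf: "has_bochner_integral M (\<lambda>t. - (?p t * f t)) (- G)"
        unfolding G_def by (intro has_bochner_integral_minus feasible_pairing f)
      have f0: "AE t in M. 0 \<le> f t" using f by (simp add: feasible_def)
      have nn: "AE t in M. 0 \<le> - (?p t * f t)"
        using neg f0 by eventually_elim (simp add: mult_nonpos_nonneg)
      then have "0 \<le> - G"
        using pf integral_nonneg_AE[OF nn] by (simp add: has_bochner_integral_iff)
      then have "(\<integral>t. - (?p t * f t) \<partial>M) = 0" using False pf by (simp add: has_bochner_integral_iff)
      moreover have "integrable M (\<lambda>t. - (?p t * f t))" using pf by (simp only: has_bochner_integral_iff)
      ultimately have "AE t in M. - (?p t * f t) = 0"
        using integral_nonneg_eq_0_iff_AE[OF _ nn, THEN iffD1] by blast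
      then have zero: "AE t in M. f t = 0"
        using neg by eventually_elim auto
      have "g i = 0" if "i \<in> I" for i
      proof -
        have "has_bochner_integral M (\<lambda>t. \<phi> i t * f t) (g i)" using f that by (simp add: feasible_def)
        moreover have "AE t in M. \<phi> i t * f t = 0" using zero by eventually_elim simp
        then have "(\<integral>t. \<phi> i t * f t \<partial>M) = 0" by (rule integral_eq_zero_AE)
        ultimately show ?thesis by (simp add: has_bochner_integral_iff)
      qed
      then show False using g by blast
    qed
    ultimately have K: "K > 0" by simp
    \<comment> \<open>makes \<open>s * K - G \<ge> B\<close> and \<open>s \<ge> 1\<close>, so that \<open>s * (s * K - G) \<ge> B\<close>\<close>
    define s where "s = (G + B) / K + 1"
    have s1: "1 \<le> s" using False K B by (simp add: s_def)
    have "s * K - G = B + K" using K by (simp add: s_def field_simps)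
    then have "1 * (B + K) \<le> s * (s * K - G)" using s1 K B by (simp add: mult_right_mono)
    then have quad: "s * G - s\<^sup>2 * K \<le> - B" using K by (simp add: algebra_simps power2_eq_square)
    have "s\<^sup>2 * K = (\<integral>t. s\<^sup>2 * (exp (- 1) / 2 * (q t * \<rho> t)) \<partial>M)"
      by (simp add: K_def)
    also have "\<dots> \<le> (\<integral>t. exp (s * exponent d t - 1) * \<rho> t \<partial>M)"
    proof (rule integral_mono_AE)
      show "integrable M (\<lambda>t. s\<^sup>2 * (exp (- 1) / 2 * (q t * \<rho> t)))" using int_q by (rule integrable_mult_right)
      show "AE t in M. s\<^sup>2 * (exp (- 1) / 2 * (q t * \<rho> t)) \<le> exp (s * exponent d t - 1) * \<rho> t"
        using \<rho>_pos
      proof eventually_elim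
        case (elim t)
        have "s\<^sup>2 * (exp (- 1) / 2 * q t) * \<rho> t \<le> exp (s * exponent d t - 1) * \<rho> t"
          using q_le[of s t] s1 elim by (intro mult_right_mono) auto
        then show ?case by (simp add: mult.assoc)
      qed
    qed (rule int)
    finally have "dual g (\<lambda>i. s * d i) \<le> - B" using quad unfolding dual by simp
    then show ?thesis using s1 B by (intro exI[of _ s]) auto
  qed
qed

lemma dual_max_exists:
  assumes "feasible g f" and "\<exists>i\<in>I. g i \<noteq> 0"
  obtains l where "\<And>k. dual g k \<le> dual g l"
proof (rule concave_attains_max_if_unbounded_below_on_rays[of I "dual g"])
  show "finite I" by (rule finite_I)
qed (use dual_concave dual_continuous dual_decreases_on_rays[OF assms] that in blast)+

text \<open>The density of \<open>l\<close> is feasible and attains the value of \<open>l'\<close>, so by the equality case of weak duality it is also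
the density of \<open>l'\<close>. If \<open>l\<close> and \<open>l'\<close> differed, this could hold almost everywhere only on a null space, where
all moments vanish.\<close>

lemma dual_max_unique:
  assumes g: "\<exists>i\<in>I. g i \<noteq> 0"
    and l: "\<And>k. dual g k \<le> dual g l" and l': "\<And>k. dual g k \<le> dual g l'"
    and i: "i \<in> I"
  shows "l i = l' i"
proof (rule ccontr)
  assume ne: "l i \<noteq> l' i"
  have feas: "feasible g (gibbs l)" using l by (rule gibbs_feasible_if_dual_max)
  have "dual g l = dual g l'" using l[of l'] l'[of l] by simp
  then have "AE t in M. gibbs l t = gibbs l' t"
    using weak_duality(2)[OF feas, of l'] strong_duality[OF feas] by simp
  moreover have "AE t in M. (\<Sum>i\<in>I. (l i - l' i) * \<phi> i t) \<noteq> 0"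
    using ne i by (intro independent) auto
  ultimately have "AE t in M. False"
    using a_pos \<rho>_pos
  proof eventually_elim
    case (elim t)
    then have "exponent l t = exponent l' t" by (simp add: gibbs_def)
    then have "(\<Sum>i\<in>I. (l i - l' i) * \<phi> i t) = 0"
      using exponent_times_a[of t l] exponent_times_a[of t l'] elim
      by (simp add: left_diff_distrib sum_subtractf)
    with elim show ?case by simp
  qed
  then have "g j = 0" if "j \<in> I" for j
  proof -
    have "has_bochner_integral M (\<lambda>t. \<phi> j t * gibbs l t) (g j)" using feas that by (simp add: feasible_def)
    moreover have "AE t in M. \<phi> j t * gibbs l t = 0"
      using \<open>AE t in M. False\<close> by eventually_elim simp
    then have "(\<integral>t. \<phi> j t * gibbs l t \<partial>M) = 0" by (rule integral_eq_zero_AE)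
    ultimately show ?thesis by (simp add: has_bochner_integral_iff)
  qed
  with g show False by blast
qed

end

section \<open>Monomials and their growth\<close>

text \<open>The lower half of the equivalence of norms: \<open>\<nu>\<close> is Lipschitz with respect to the Euclidean norm, hence
has a positive minimum on the unit sphere.\<close>

lemma norm_le_mult_is_norm:
  fixes \<nu> :: "'a::euclidean_space \<Rightarrow> real"
  assumes zero: "\<And>x. \<nu> x = 0 \<longleftrightarrow> x = 0"
    and scale: "\<And>c x. \<nu> (c *\<^sub>R x) = \<bar>c\<bar> * \<nu> x"
    and tri: "\<And>x y. \<nu> (x + y) \<le> \<nu> x + \<nu> y"
  obtains C where "C > 0" "\<And>x. norm x \<le> C * \<nu> x"
proof -
  have sym: "\<nu> (- x) = \<nu> x" for x using scale[of "-1" x] by simp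
  have nonneg: "0 \<le> \<nu> x" for x using tri[of x "- x"] zero[of 0] sym[of x] by simp
  define K where "K = (\<Sum>b\<in>Basis. \<nu> b)"
  have sum_le: "\<nu> (\<Sum>b\<in>S. h b) \<le> (\<Sum>b\<in>S. \<nu> (h b))" if "finite S" for S and h :: "'a \<Rightarrow> 'a"
    using that
  proof induction
    case empty then show ?case using zero[of 0] by simp
  next
    case (insert b S) then show ?case using tri[of "h b" "\<Sum>b\<in>S. h b"] by simp
  qed
  have upper: "\<nu> x \<le> K * norm x" for x
  proof -
    have "\<nu> x = \<nu> (\<Sum>b\<in>Basis. (x \<bullet> b) *\<^sub>R b)" by (simp add: euclidean_representation)
    also have "\<dots> \<le> (\<Sum>b\<in>Basis. \<bar>x \<bullet> b\<bar> * \<nu> b)" using sum_le[of Basis "\<lambda>b. (x \<bullet> b) *\<^sub>R b"] by (simp add: scale)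
    also have "\<dots> \<le> (\<Sum>b\<in>Basis. norm x * \<nu> b)"
      by (intro sum_mono mult_right_mono nonneg) (simp add: Basis_le_norm)
    finally show ?thesis by (simp add: K_def sum_distrib_left mult.commute)
  qed
  have "K-lipschitz_on UNIV \<nu>"
  proof (rule lipschitz_onI)
    show "0 \<le> K" by (simp add: K_def nonneg sum_nonneg)
    fix x y :: 'a
    have "\<nu> x - \<nu> y \<le> K * norm (x - y)" for x y
      using tri[of "x - y" y] upper[of "x - y"] by simp
    from this[of x y] this[of y x] show "dist (\<nu> x) (\<nu> y) \<le> K * dist x y"
      by (simp add: dist_real_def dist_norm abs_le_iff norm_minus_commute)
  qed
  then have "continuous_on (sphere 0 1) \<nu>"
    using lipschitz_on_continuous_on continuous_on_subset by blast
  moreover have "sphere (0::'a) 1 \<noteq> {}"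
    using norm_Basis nonempty_Basis by fastforce
  ultimately obtain u where u: "norm u = 1" "\<And>x. norm x = 1 \<Longrightarrow> \<nu> u \<le> \<nu> x"
    using continuous_attains_inf[of "sphere (0::'a) 1" \<nu>] by auto
  have "\<nu> u > 0" using u(1) zero[of u] nonneg[of u] by (metis norm_zero order_less_le zero_neq_one)
  moreover have "norm x \<le> (1 / \<nu> u) * \<nu> x" for x
  proof (cases "x = 0")
    case False
    then have "\<nu> u \<le> \<nu> ((1 / norm x) *\<^sub>R x)" by (intro u(2)) simp
    then show ?thesis using False \<open>\<nu> u > 0\<close> by (simp add: scale field_simps)
  qed (use zero[of 0] in simp)
  ultimately show thesis by (intro that[of "1 / \<nu> u"]) auto
qed

lemma abs_mpow_le_norm_power: "\<bar>mpow t i\<bar> \<le> norm t ^ multi_deg i"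
proof -
  have "\<bar>mpow t i\<bar> = (\<Prod>k\<in>UNIV. \<bar>t $ k\<bar> ^ (i $ k))"
    by (simp add: mpow_def abs_prod power_abs)
  also have "\<dots> \<le> (\<Prod>k\<in>UNIV. norm t ^ (i $ k))"
    by (intro prod_mono conjI power_mono) (auto simp: component_le_norm_cart)
  also have "\<dots> = norm t ^ multi_deg i" by (simp add: multi_deg_def power_sum)
  finally show ?thesis .
qed

text \<open>Degrees below \<open>m\<close> are covered as well, since \<open>x ^ j \<le> x ^ m + 1\<close> for \<open>x \<ge> 0\<close> and \<open>j \<le> m\<close>.\<close>

lemma sum_abs_mpow_le:
  fixes I :: "(nat ^ 'n) set" and \<nu> :: "real ^ 'n \<Rightarrow> real"
  assumes "finite I" and "is_norm \<nu>" and m: "\<And>i. i \<in> I \<Longrightarrow> multi_deg i \<le> m"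
  obtains C where "0 \<le> C" "\<And>t. 0 \<le> \<nu> t" "\<And>t. (\<Sum>i\<in>I. \<bar>mpow t i\<bar>) \<le> C * (\<nu> t ^ m + 1)"
proof -
  obtain c where c: "c > 0" "\<And>x. norm x \<le> c * \<nu> x"
    using norm_le_mult_is_norm[of \<nu>] assms(2) unfolding is_norm_def by metis
  have \<nu>: "0 \<le> \<nu> t" for t
    using c(1) order_trans[OF norm_ge_zero c(2)[of t]] by (simp add: zero_le_mult_iff)
  have one: "\<bar>mpow t i\<bar> \<le> (c ^ m + 1) * (\<nu> t ^ m + 1)" if "i \<in> I" for t i
  proof -
    have "norm t ^ multi_deg i \<le> norm t ^ m + 1"
    proof (cases "norm t \<le> 1")
      case True
      then show ?thesis by (simp add: add_increasing power_le_one)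
    next
      case False
      then show ?thesis using power_increasing[OF m[OF that], of "norm t"] by linarith
    qed
    also have "\<dots> \<le> (c * \<nu> t) ^ m + 1" using power_mono[OF c(2), of t m] by simp
    also have "\<dots> \<le> (c ^ m + 1) * (\<nu> t ^ m + 1)"
      using c(1) \<nu>[of t] by (simp add: power_mult_distrib algebra_simps)
    finally show ?thesis using abs_mpow_le_norm_power[of t i] by linarith
  qed
  show thesis
  proof (rule that)
    show "0 \<le> real (card I) * (c ^ m + 1)" using c(1) by simp
    show "(\<Sum>i\<in>I. \<bar>mpow t i\<bar>) \<le> real (card I) * (c ^ m + 1) * (\<nu> t ^ m + 1)" for t
      using sum_bounded_above[of I "\<lambda>i. \<bar>mpow t i\<bar>", OF one] by (simp add: mult.assoc)
  qed (rule \<nu>)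
qed

text \<open>Turns the growth hypothesis, which has the parameter in the denominator, into exponential moments of
every order. The choice \<open>\<alpha> = 1 / (\<bar>c\<bar> * C + 1)\<close> is positive also for \<open>c = 0\<close>.\<close>

lemma integrable_exp_mult_if_dominated:
  fixes a \<rho> u v :: "'a \<Rightarrow> real"
  assumes [measurable]: "a \<in> borel_measurable M" "\<rho> \<in> borel_measurable M" "v \<in> borel_measurable M"
    and a: "AE t in M. 0 < a t" and \<rho>: "AE t in M. 0 < \<rho> t"
    and C: "0 \<le> C" and u: "\<And>t. 0 \<le> u t" and v: "\<And>t. 0 \<le> v t" "\<And>t. v t \<le> C * u t"
    and fin: "\<And>\<alpha>. \<alpha> > 0 \<Longrightarrow> (\<integral>\<^sup>+t. ennreal (exp (u t / (\<alpha> * a t)) * \<rho> t) \<partial>M) < \<infinity>"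
  shows "integrable M (\<lambda>t. exp (c * (v t / a t)) * \<rho> t)"
proof (rule integrableI_bounded)
  define \<alpha> where "\<alpha> = 1 / (\<bar>c\<bar> * C + 1)"
  have D: "\<bar>c\<bar> * C + 1 > 0" using C by (simp add: add_nonneg_pos)
  then have \<alpha>: "\<alpha> > 0" by (simp add: \<alpha>_def)
  have "(\<integral>\<^sup>+t. ennreal (norm (exp (c * (v t / a t)) * \<rho> t)) \<partial>M)
      \<le> (\<integral>\<^sup>+t. ennreal (exp (u t / (\<alpha> * a t)) * \<rho> t) \<partial>M)"
  proof (rule nn_integral_mono_AE)
    show "AE t in M. ennreal (norm (exp (c * (v t / a t)) * \<rho> t)) \<le> ennreal (exp (u t / (\<alpha> * a t)) * \<rho> t)"
      using a \<rho>
    proof eventually_elim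
      case (elim t)
      have "c * v t \<le> \<bar>c\<bar> * v t" using v(1)[of t] by (intro mult_right_mono) auto
      also have "\<dots> \<le> \<bar>c\<bar> * (C * u t)" using v(2)[of t] by (intro mult_left_mono) auto
      also have "\<dots> \<le> (\<bar>c\<bar> * C + 1) * u t" using u[of t] by (simp add: algebra_simps)
      finally have "c * v t / a t \<le> (\<bar>c\<bar> * C + 1) * u t / a t"
        using elim by (intro divide_right_mono) auto
      moreover have "(\<bar>c\<bar> * C + 1) * u t / a t = u t / (\<alpha> * a t)" by (simp add: \<alpha>_def)
      ultimately show ?case using elim by (intro ennreal_leI) (simp add: abs_mult)
    qed
  qed
  also have "\<dots> < \<infinity>" by (rule fin[OF \<alpha>])
  finally show "(\<integral>\<^sup>+t. ennreal (norm (exp (c * (v t / a t)) * \<rho> t)) \<partial>M) < \<infinity>" .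
qed measurable

lemma mpow_0: "mpow t 0 = 1"
  by (simp add: mpow_def)

lemma meas_mpow: "closed T \<Longrightarrow> (\<lambda>t. mpow t i) \<in> borel_measurable (lebesgue_on T)"
  unfolding mpow_def
  by (intro continuous_imp_measurable_on_sets_lebesgue continuous_intros) (simp add: borel_closed)

lemma AE_polynomial_nonzero:
  fixes T :: "(real ^ 'n) set"
  assumes "closed T" "finite I" "\<exists>i\<in>I. d i \<noteq> 0"
  shows "AE t in lebesgue_on T. (\<Sum>i\<in>I. d i * mpow t i) \<noteq> 0"
proof -
  have "{t. (\<Sum>i\<in>I. d i * mpow t i) = 0} \<in> null_sets lebesgue"
    using negligible_zeros_polynomial[OF assms(2,3)] by (simp add: negligible_iff_null_sets)
  then have "AE t in lebesgue. (\<Sum>i\<in>I. d i * mpow t i) \<noteq> 0"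
    by (rule AE_I') auto
  then show ?thesis
    using assms(1) by (subst AE_restrict_space_iff) (auto simp: borel_closed)
qed

section \<open>Equivalence of solvability, entropy maximization and dual attainment\<close>

theorem theorem4:
  fixes T :: "(real ^ 'n) set"
    and I :: "(nat ^ 'n) set"
    and g :: "nat ^ 'n \<Rightarrow> real"
    and a \<rho> :: "real ^ 'n \<Rightarrow> real"
    and \<nu> :: "real ^ 'n \<Rightarrow> real"
    and m :: nat
  assumes "closed T"
    and "finite I" and "0 \<in> I" and "g 0 = 1"
    and "m = Max (multi_deg ` I)"
    and "is_norm \<nu>"
    and "a \<in> borel_measurable (lebesgue_on T)"
    and "\<rho> \<in> borel_measurable (lebesgue_on T)"
    and "AE t in lebesgue_on T. 0 < a t"
    and "AE t in lebesgue_on T. 0 < \<rho> t"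
    and "\<forall>\<alpha>>0. (\<integral>\<^sup>+ t. ennreal (exp (((\<nu> t) ^ m + 1) / (\<alpha> * a t)) * \<rho> t) \<partial>lebesgue_on T) < \<infinity>"
    and "indep_of_monomials T (I - {0}) a"
  shows
    "(\<forall>f\<in>L1_plus T. entropy T a \<rho> f < \<infinity>) \<and>
     (\<forall>l \<in> I \<rightarrow>\<^sub>E UNIV. dual_functional T I g a \<rho> l < \<infinity>) \<and>
     ((\<exists>f. moment_solution T I g f) \<longleftrightarrow>
      (\<exists>f. entropy_maximizer T I g a \<rho> f)) \<and>
     ((\<exists>f. entropy_maximizer T I g a \<rho> f) \<longleftrightarrow>
      (\<exists>B::real. \<forall>l \<in> I \<rightarrow>\<^sub>E UNIV. dual_functional T I g a \<rho> l \<le> ereal B) \<and>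
      (\<exists>l. dual_maximizer T I g a \<rho> l)) \<and>
     ((\<exists>f. moment_solution T I g f) \<longrightarrow>
      (\<exists>f l.
         entropy_maximizer T I g a \<rho> f \<and>
         (\<forall>f'. entropy_maximizer T I g a \<rho> f' \<longrightarrow> (AE t in lebesgue_on T. f' t = f t)) \<and>
         dual_maximizer T I g a \<rho> l \<and>
         (\<forall>l'. dual_maximizer T I g a \<rho> l' \<longrightarrow> l' = l) \<and>
         - entropy T a \<rho> f = dual_functional T I g a \<rho> l \<and>
         (AE t in lebesgue_on T.
            f t = inverse (a t) * \<rho> t * exp ((\<Sum>i\<in>I. l i * mpow t i / a t) - 1)) \<and>
         (\<exists>h. moment_solution T I g h \<and> entropy T a \<rho> h \<noteq> - \<infinity>) \<and>
         (\<forall>i\<in>I. has_bochner_integral (lebesgue_on T)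
            (\<lambda>t. mpow t i * exp (1 / a t * (\<Sum>j\<in>I. l j * mpow t j) - 1) * inverse (a t) * \<rho> t)
            (g i))))"
proof -
  let ?M = "lebesgue_on T"
  note [measurable] = assms(7,8) meas_mpow[OF assms(1)]
  have deg: "multi_deg i \<le> m" if "i \<in> I" for i
    using assms(2,5) that by simp
  obtain C where C: "0 \<le> C" "\<And>t. 0 \<le> \<nu> t" "\<And>t. (\<Sum>i\<in>I. \<bar>mpow t i\<bar>) \<le> C * (\<nu> t ^ m + 1)"
    using sum_abs_mpow_le[OF assms(2,6) deg] by blast
  interpret independent_moment_duality ?M I "\<lambda>i t. mpow t i" a \<rho>
  proof
    show "integrable ?M (\<lambda>t. exp (c * ((\<Sum>i\<in>I. \<bar>mpow t i\<bar>) / a t)) * \<rho> t)" for c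
    proof (rule integrable_exp_mult_if_dominated[OF assms(7,8) _ assms(9,10) C(1)])
      show "(\<integral>\<^sup>+ t. ennreal (exp ((\<nu> t ^ m + 1) / (\<alpha> * a t)) * \<rho> t) \<partial>?M) < \<infinity>" if "\<alpha> > 0" for \<alpha>
        using assms(11) that by blast
    qed (use C in \<open>auto intro!: sum_nonneg\<close>)
    show "AE t in ?M. (\<Sum>i\<in>I. d i * mpow t i) \<noteq> 0" if "\<exists>i\<in>I. d i \<noteq> 0" for d
      using AE_polynomial_nonzero[OF assms(1,2) that] .
  qed (use assms(2,7-10) meas_mpow[OF assms(1)] in auto)

  \<comment> \<open>integrability of \<open>f\<close> itself is the case \<open>i = 0\<close> of the moment conditions\<close>
  have solution_iff: "moment_solution T I g f \<longleftrightarrow> feasible g f" for f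
  proof
    assume f: "moment_solution T I g f"
    then have [measurable]: "f \<in> borel_measurable ?M" by (auto simp: moment_solution_def L1_plus_def)
    have "integrable ?M (\<lambda>t. mpow t i * f t)" if "i \<in> I" for i
    proof (rule Bochner_Integration.integrable_bound)
      show "integrable ?M (\<lambda>t. \<bar>mpow t i\<bar> * f t)" using f that by (simp add: moment_solution_def)
    qed (auto simp: abs_mult)
    then show "feasible g f"
      using f by (auto simp: feasible_def moment_solution_def L1_plus_def has_bochner_integral_iff)
  next
    assume f: "feasible g f"
    then have [measurable]: "f \<in> borel_measurable ?M" by (auto simp: feasible_def)
    have int: "integrable ?M (\<lambda>t. mpow t i * f t)" if "i \<in> I" for i
      using f that by (simp add: feasible_def has_bochner_integral_iff)
    have "integrable ?M (\<lambda>t. \<bar>mpow t i\<bar> * f t)" if "i \<in> I" for i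
      by (rule Bochner_Integration.integrable_bound[OF int[OF that]]) (auto simp: abs_mult)
    moreover have "integrable ?M f" using int[OF assms(3)] by (simp add: mpow_0)
    ultimately show "moment_solution T I g f"
      using f by (auto simp: feasible_def moment_solution_def L1_plus_def has_bochner_integral_iff)
  qed
  have entropy_eq: "entropy T a \<rho> f = - ext_integral ?M (primal_integrand f)" for f
    unfolding entropy_def primal_integrand_def ..
  have maximizer_iff: "entropy_maximizer T I g a \<rho> f \<longleftrightarrow> feasible g f \<and>
      (\<forall>h. feasible g h \<longrightarrow> ext_integral ?M (primal_integrand f) \<le> ext_integral ?M (primal_integrand h))" for f
    by (simp add: entropy_maximizer_def solution_iff entropy_eq)
  have dual_eq: "dual_functional T I g a \<rho> l = ereal (dual g l)" for l
  proof -
    have "AE t in ?M. 0 \<le> exp (exponent l t - 1) * \<rho> t" using \<rho>_pos by eventually_elim simp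
    then have "(\<integral>\<^sup>+ t. ennreal (exp (exponent l t - 1) * \<rho> t) \<partial>?M)
        = ennreal (\<integral>t. exp (exponent l t - 1) * \<rho> t \<partial>?M)" "0 \<le> (\<integral>t. exp (exponent l t - 1) * \<rho> t \<partial>?M)"
      by (auto intro: nn_integral_eq_integral exp_exponent_integrable integral_nonneg_AE)
    then show ?thesis
      unfolding dual_functional_def exponent_def[symmetric] dual_def by (simp add: enn2ereal_ennreal)
  qed
  \<comment> \<open>the dual only depends on the values on \<open>I\<close>, so that maximizing over extensional functions is the same
    as maximizing over all functions\<close>
  have dual_maximizer_iff: "dual_maximizer T I g a \<rho> l \<longleftrightarrow>
      l \<in> I \<rightarrow>\<^sub>E UNIV \<and> (\<forall>k. dual g k \<le> dual g l)" for l
  proof (cases "l \<in> I \<rightarrow>\<^sub>E UNIV")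
    case True
    have restr: "restrict k I \<in> I \<rightarrow>\<^sub>E UNIV" "dual g (restrict k I) = dual g k" for k
      by (auto intro: dual_cong)
    have "dual_maximizer T I g a \<rho> l \<longleftrightarrow> (\<forall>k \<in> I \<rightarrow>\<^sub>E UNIV. ereal (dual g k) \<le> ereal (dual g l))"
    proof
      assume "dual_maximizer T I g a \<rho> l"
      then have "ereal (dual g l) = (SUP k \<in> I \<rightarrow>\<^sub>E UNIV. ereal (dual g k))"
        by (simp only: dual_maximizer_def dual_eq)
      then show "\<forall>k \<in> I \<rightarrow>\<^sub>E UNIV. ereal (dual g k) \<le> ereal (dual g l)"
        by (auto intro: SUP_upper simp del: ereal_less_eq)
    next
      assume "\<forall>k \<in> I \<rightarrow>\<^sub>E UNIV. ereal (dual g k) \<le> ereal (dual g l)"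
      then show "dual_maximizer T I g a \<rho> l"
        using True unfolding dual_maximizer_def dual_eq
        by (intro conjI order_antisym SUP_upper SUP_least) auto
    qed
    then show ?thesis using True restr by (simp only: ereal_less_eq(3)) (metis restr)
  qed (simp add: dual_maximizer_def)

  have g: "\<exists>i\<in>I. g i \<noteq> 0" using assms(3,4) by (intro bexI[of _ 0]) auto
  have attained: "\<exists>l. dual_maximizer T I g a \<rho> l" if f: "feasible g f" for f
  proof -
    obtain l where "\<And>k. dual g k \<le> dual g l" using dual_max_exists[OF f g] by blast
    then show ?thesis
      by (intro exI[of _ "restrict l I"]) (auto simp: dual_maximizer_iff dual_cong[of "restrict l I" l])
  qed
  have optimal: "entropy_maximizer T I g a \<rho> (gibbs l) \<and>
         (\<forall>f'. entropy_maximizer T I g a \<rho> f' \<longrightarrow> (AE t in lebesgue_on T. f' t = gibbs l t)) \<and>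
         dual_maximizer T I g a \<rho> l \<and>
         (\<forall>l'. dual_maximizer T I g a \<rho> l' \<longrightarrow> l' = l) \<and>
         - entropy T a \<rho> (gibbs l) = dual_functional T I g a \<rho> l \<and>
         (AE t in lebesgue_on T.
            gibbs l t = inverse (a t) * \<rho> t * exp ((\<Sum>i\<in>I. l i * mpow t i / a t) - 1)) \<and>
         (\<exists>h. moment_solution T I g h \<and> entropy T a \<rho> h \<noteq> - \<infinity>) \<and>
         (\<forall>i\<in>I. has_bochner_integral (lebesgue_on T)
            (\<lambda>t. mpow t i * exp (1 / a t * (\<Sum>j\<in>I. l j * mpow t j) - 1) * inverse (a t) * \<rho> t)
            (g i))" if l: "dual_maximizer T I g a \<rho> l" for l
  proof (intro conjI allI impI)
    have max: "\<And>k. dual g k \<le> dual g l" and ext: "l \<in> I \<rightarrow>\<^sub>E UNIV"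
      using l by (auto simp: dual_maximizer_iff)
    have feas: "feasible g (gibbs l)" by (rule gibbs_feasible_if_dual_max[OF max])
    have strong: "ext_integral ?M (primal_integrand (gibbs l)) = ereal (dual g l)"
      by (rule strong_duality[OF feas])
    show primal: "entropy_maximizer T I g a \<rho> (gibbs l)"
      using feas weak_duality(1) by (simp add: maximizer_iff strong)
    show "AE t in ?M. f' t = gibbs l t" if "entropy_maximizer T I g a \<rho> f'" for f'
    proof (rule weak_duality(2))
      show f': "feasible g f'" using that by (simp add: maximizer_iff)
      show "ext_integral ?M (primal_integrand f') = ereal (dual g l)"
        using that feas weak_duality(1)[OF f', of l] strong by (intro antisym) (auto simp: maximizer_iff)
    qed
    show "dual_maximizer T I g a \<rho> l" by (rule l)
    show "l' = l" if "dual_maximizer T I g a \<rho> l'" for l'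
    proof (rule PiE_ext[of _ I "\<lambda>_. UNIV"])
      show "l' \<in> I \<rightarrow>\<^sub>E UNIV" using that by (simp add: dual_maximizer_iff)
      show "l' i = l i" if "i \<in> I" for i
        using dual_max_unique[OF g _ max that, of l'] \<open>dual_maximizer T I g a \<rho> l'\<close>
        by (simp add: dual_maximizer_iff)
    qed (rule ext)
    show "- entropy T a \<rho> (gibbs l) = dual_functional T I g a \<rho> l"
      by (simp add: entropy_eq strong dual_eq)
    show "AE t in ?M. gibbs l t = inverse (a t) * \<rho> t * exp ((\<Sum>i\<in>I. l i * mpow t i / a t) - 1)"
      by (simp add: gibbs_def exponent_def)
    show "\<exists>h. moment_solution T I g h \<and> entropy T a \<rho> h \<noteq> - \<infinity>"
      using feas by (intro exI[of _ "gibbs l"]) (simp add: solution_iff entropy_eq strong)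
    have density: "mpow t i * exp (1 / a t * (\<Sum>j\<in>I. l j * mpow t j) - 1) * inverse (a t) * \<rho> t = mpow t i * gibbs l t" for i t
      by (simp add: gibbs_def exponent_def sum_divide_distrib[symmetric])
    show "\<forall>i\<in>I. has_bochner_integral ?M
            (\<lambda>t. mpow t i * exp (1 / a t * (\<Sum>j\<in>I. l j * mpow t j) - 1) * inverse (a t) * \<rho> t) (g i)"
      using feas unfolding feasible_def density by blast
  qed
  have solvable: "\<exists>l. dual_maximizer T I g a \<rho> l" if "\<exists>f. moment_solution T I g f"
    using that attained by (auto simp: solution_iff)
  have primal_sol: "\<exists>f. moment_solution T I g f" if "\<exists>f. entropy_maximizer T I g a \<rho> f"
    using that by (auto simp: entropy_maximizer_def)
  have bounded: "\<exists>B::real. \<forall>l \<in> I \<rightarrow>\<^sub>E UNIV. dual_functional T I g a \<rho> l \<le> ereal B"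
    if "dual_maximizer T I g a \<rho> l" for l
    using that by (auto simp: dual_maximizer_iff dual_eq)
  show ?thesis
  proof (intro conjI)
    show "\<forall>f\<in>L1_plus T. entropy T a \<rho> f < \<infinity>"
    proof
      fix f assume "f \<in> L1_plus T"
      then have "- \<infinity> < ext_integral ?M (primal_integrand f)"
        by (intro primal_gt_minus_infinity) (simp add: L1_plus_def)
      then show "entropy T a \<rho> f < \<infinity>"
        unfolding entropy_eq by (cases "ext_integral ?M (primal_integrand f)") auto
    qed
    show "\<forall>l \<in> I \<rightarrow>\<^sub>E UNIV. dual_functional T I g a \<rho> l < \<infinity>" by (simp add: dual_eq)
    show "(\<exists>f. moment_solution T I g f) \<longleftrightarrow> (\<exists>f. entropy_maximizer T I g a \<rho> f)"
      using solvable primal_sol optimal by blast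
    show "(\<exists>f. entropy_maximizer T I g a \<rho> f) \<longleftrightarrow>
      (\<exists>B::real. \<forall>l \<in> I \<rightarrow>\<^sub>E UNIV. dual_functional T I g a \<rho> l \<le> ereal B) \<and>
      (\<exists>l. dual_maximizer T I g a \<rho> l)"
      using solvable primal_sol optimal bounded by blast
  qed (intro impI, drule solvable, elim exE, intro exI, erule optimal)
qed

end
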